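(* If $(\mathcal{C},\mathcal{W})$ is a homotopical category which is deformable into a subcategory $\mathcal{C}_0$ such that $(\mathcal{C}_0,\mathcal{W}_0)$, with $\mathcal{W}_0$ the restriction of $\mathcal{W}$ to $\mathcal{C}_0$, is split-generated and satisfies the "fork" condition, then $(\mathcal{C},\mathcal{W})$ is saturated.
   Context: A category with weak equivalences is a pair $(\mathcal{C},\mathcal{W})$ where $\mathcal{W}$ is a family of arrows of the category $\mathcal{C}$ (the weak equivalences) containing all identities and having the two out of three property. It is a homotopical category if moreover it has the weak invertibility property: if $f$ is an arrow for which there exist arrows $g,h$ with $fg\in\mathcal{W}$ and $hf\in\mathcal{W}$, then $f\in\mathcal{W}$. It is split-generated if every arrow of $\mathcal{W}$ is a (finite) composition of arrows of $\mathcal{W}$ each of which is a section (has a left inverse) or a retraction (has a right inverse). It is saturated if every arrow $f$ of $\mathcal{C}$ such that $\gamma f$ is an isomorphism is in $\mathcal{W}$, where $\gamma:\mathcal{C}\to Ho(\mathcal{C})$ is the localization of $\mathcal{C}$ with respect to $\mathcal{W}$ (the universal functor sending arrows of $\mathcal{W}$ to isomorphisms; size issues are ignored). A left (resp. right) deformation of $(\mathcal{C},\mathcal{W})$ into a subcategory $\mathcal{C}'$ is a functor $r:\mathcal{C}\to\mathcal{C}$ preserving weak equivalences with $rX\in\mathcal{C}'$ for each object $X$, together with a natural transformation $\theta:r\Rightarrow id_{\mathcal{C}}$ (resp. $\theta:id_{\mathcal{C}}\Rightarrow r$) all of whose components are weak equivalences. $\mathcal{C}$ is deformable into $\mathcal{C}_0$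 if there is a finite sequence of subcategories $\mathcal{C}\supseteq\mathcal{C}_1\supseteq\cdots\supseteq\mathcal{C}_n=\mathcal{C}_0$, with restricted weak equivalences, and (left or right) deformations of $\mathcal{C}$ into $\mathcal{C}_1$ and of $\mathcal{C}_{i-1}$ into $\mathcal{C}_i$ for $2\le i\le n$. The "fork" condition for a category with weak equivalences: for all parallel arrows $f,g:A\to B$, - if there are arrows $\alpha:A\to C$, $\partial_0,\partial_1:A\to\widetilde{A}$, $\sigma:\widetilde{A}\to C$, $h:\widetilde{A}\to B$ with $\sigma$ a weak equivalence, $\sigma\partial_0=\sigma\partial_1=\alpha$, $h\partial_0=f$, $h\partial_1=g$ (written $f\,R_\ell^c\,g$), then there are such data in which $\alpha$ is also a weak equivalence; - if there are arrows $\beta:C\to B$, $d_0,d_1:\widetilde{B}\to B$, $s:C\to\widetilde{B}$, $k:A\to\widetilde{B}$ with $s$ a weak equivalence, $d_0s=d_1s=\beta$, $d_0k=f$, $d_1k=g$ (written $f\,R_r^c\,g$), then there are such data in which $\beta$ is also a weak equivalence. For $(\mathcal{C}_0,\mathcal{W}_0)$ all these data are in $\mathcal{C}_0$.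
   Formalization: A deformation into a subcategory C' is required to send arrows as well as objects into C' (automatic when C' is full); with objects alone, r = id and the subcategory of identities would make every homotopical category saturated, which is false. *)

theory Defs
  imports Main
begin

section \<open>Categories, functors, natural transformations\<close>

text \<open>\<open>g \<cdot>\<^bsub>C\<^esub> f\<close> is \<open>g\<close> after \<open>f\<close>; its value is unspecified unless \<open>Dom C g = Cod C f\<close>.\<close>

record ('o, 'm) cat =
  Obj :: "'o set"
  Arr :: "'m set"
  Dom :: "'m \<Rightarrow> 'o"
  Cod :: "'m \<Rightarrow> 'o"
  Ident :: "'o \<Rightarrow> 'm"
  Comp :: "'m \<Rightarrow> 'm \<Rightarrow> 'm" (infixl "\<cdot>\<index>" 70)

locale category =
  fixes C :: "('o, 'm) cat" (structure)
  assumes Dom_Obj: "f \<in> Arr C \<Longrightarrow> Dom C f \<in> Obj C"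
    and Cod_Obj: "f \<in> Arr C \<Longrightarrow> Cod C f \<in> Obj C"
    and Ident_Arr: "X \<in> Obj C \<Longrightarrow> Ident C X \<in> Arr C"
    and Dom_Ident: "X \<in> Obj C \<Longrightarrow> Dom C (Ident C X) = X"
    and Cod_Ident: "X \<in> Obj C \<Longrightarrow> Cod C (Ident C X) = X"
    and Comp_Arr: "\<lbrakk>f \<in> Arr C; g \<in> Arr C; Dom C g = Cod C f\<rbrakk> \<Longrightarrow> g \<cdot> f \<in> Arr C"
    and Dom_Comp: "\<lbrakk>f \<in> Arr C; g \<in> Arr C; Dom C g = Cod C f\<rbrakk> \<Longrightarrow> Dom C (g \<cdot> f) = Dom C f"
    and Cod_Comp: "\<lbrakk>f \<in> Arr C; g \<in> Arr C; Dom C g = Cod C f\<rbrakk> \<Longrightarrow> Cod C (g \<cdot> f) = Cod C g"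
    and Comp_Ident: "f \<in> Arr C \<Longrightarrow> f \<cdot> Ident C (Dom C f) = f"
    and Ident_Comp: "f \<in> Arr C \<Longrightarrow> Ident C (Cod C f) \<cdot> f = f"
    and Comp_assoc: "\<lbrakk>f \<in> Arr C; g \<in> Arr C; h \<in> Arr C; Dom C g = Cod C f; Dom C h = Cod C g\<rbrakk>
      \<Longrightarrow> h \<cdot> (g \<cdot> f) = h \<cdot> g \<cdot> f"

definition hom :: "('o, 'm) cat \<Rightarrow> 'o \<Rightarrow> 'o \<Rightarrow> 'm set" where
  "hom C X Y = {f \<in> Arr C. Dom C f = X \<and> Cod C f = Y}"

definition inverse_arrows :: "('o, 'm) cat \<Rightarrow> 'm \<Rightarrow> 'm \<Rightarrow> bool" where
  "inverse_arrows C f g \<longleftrightarrow> f \<in> Arr C \<and> g \<in> hom C (Cod C f) (Dom C f) \<and>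
     g \<cdot>\<^bsub>C\<^esub> f = Ident C (Dom C f) \<and> f \<cdot>\<^bsub>C\<^esub> g = Ident C (Cod C f)"

definition isomorphism :: "('o, 'm) cat \<Rightarrow> 'm \<Rightarrow> bool" where
  "isomorphism C f \<longleftrightarrow> (\<exists>g. inverse_arrows C f g)"

definition is_section :: "('o, 'm) cat \<Rightarrow> 'm \<Rightarrow> bool" where
  "is_section C f \<longleftrightarrow> f \<in> Arr C \<and>
     (\<exists>g \<in> hom C (Cod C f) (Dom C f). g \<cdot>\<^bsub>C\<^esub> f = Ident C (Dom C f))"

definition is_retraction :: "('o, 'm) cat \<Rightarrow> 'm \<Rightarrow> bool" where
  "is_retraction C f \<longleftrightarrow> f \<in> Arr C \<and>
     (\<exists>g \<in> hom C (Cod C f) (Dom C f). f \<cdot>\<^bsub>C\<^esub> g = Ident C (Cod C f))"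

definition is_functor ::
  "('o, 'm) cat \<Rightarrow> ('p, 'n) cat \<Rightarrow> ('o \<Rightarrow> 'p) \<Rightarrow> ('m \<Rightarrow> 'n) \<Rightarrow> bool" where
  "is_functor C D Fo Fa \<longleftrightarrow>
     (\<forall>X \<in> Obj C. Fo X \<in> Obj D \<and> Fa (Ident C X) = Ident D (Fo X)) \<and>
     (\<forall>f \<in> Arr C. Fa f \<in> hom D (Fo (Dom C f)) (Fo (Cod C f))) \<and>
     (\<forall>f \<in> Arr C. \<forall>g \<in> Arr C. Dom C g = Cod C f \<longrightarrow> Fa (g \<cdot>\<^bsub>C\<^esub> f) = Fa g \<cdot>\<^bsub>D\<^esub> Fa f)"

definition nat_transf ::
  "('o, 'm) cat \<Rightarrow> ('p, 'n) cat \<Rightarrow> ('o \<Rightarrow> 'p) \<Rightarrow> ('m \<Rightarrow> 'n) \<Rightarrow> ('o \<Rightarrow> 'p) \<Rightarrow> ('m \<Rightarrow> 'n)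
     \<Rightarrow> ('o \<Rightarrow> 'n) \<Rightarrow> bool" where
  "nat_transf C D Fo Fa Go Ga \<theta> \<longleftrightarrow>
     (\<forall>X \<in> Obj C. \<theta> X \<in> hom D (Fo X) (Go X)) \<and>
     (\<forall>f \<in> Arr C. \<theta> (Cod C f) \<cdot>\<^bsub>D\<^esub> Fa f = Ga f \<cdot>\<^bsub>D\<^esub> \<theta> (Dom C f))"

definition subcategory :: "('o, 'm) cat \<Rightarrow> ('o, 'm) cat \<Rightarrow> bool" where
  "subcategory D C \<longleftrightarrow> category D \<and> category C \<and> Obj D \<subseteq> Obj C \<and> Arr D \<subseteq> Arr C \<and>
     (\<forall>f \<in> Arr D. Dom D f = Dom C f \<and> Cod D f = Cod C f) \<and>
     (\<forall>X \<in> Obj D. Ident D X = Ident C X) \<and>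
     (\<forall>f \<in> Arr D. \<forall>g \<in> Arr D. Dom D g = Cod D f \<longrightarrow> g \<cdot>\<^bsub>D\<^esub> f = g \<cdot>\<^bsub>C\<^esub> f)"


section \<open>Weak equivalences\<close>

definition two_out_of_three :: "('o, 'm) cat \<Rightarrow> 'm set \<Rightarrow> bool" where
  "two_out_of_three C W \<longleftrightarrow> (\<forall>f \<in> Arr C. \<forall>g \<in> Arr C. Dom C g = Cod C f \<longrightarrow>
     (f \<in> W \<and> g \<in> W \<longrightarrow> g \<cdot>\<^bsub>C\<^esub> f \<in> W) \<and>
     (f \<in> W \<and> g \<cdot>\<^bsub>C\<^esub> f \<in> W \<longrightarrow> g \<in> W) \<and>
     (g \<in> W \<and> g \<cdot>\<^bsub>C\<^esub> f \<in> W \<longrightarrow> f \<in> W))"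

definition weq_category :: "('o, 'm) cat \<Rightarrow> 'm set \<Rightarrow> bool" where
  "weq_category C W \<longleftrightarrow>
     category C \<and> W \<subseteq> Arr C \<and> (\<forall>X \<in> Obj C. Ident C X \<in> W) \<and> two_out_of_three C W"

definition weak_invertibility :: "('o, 'm) cat \<Rightarrow> 'm set \<Rightarrow> bool" where
  "weak_invertibility C W \<longleftrightarrow> (\<forall>f \<in> Arr C. \<forall>g \<in> Arr C. \<forall>h \<in> Arr C.
     Dom C f = Cod C g \<and> Dom C h = Cod C f \<and> f \<cdot>\<^bsub>C\<^esub> g \<in> W \<and> h \<cdot>\<^bsub>C\<^esub> f \<in> W \<longrightarrow> f \<in> W)"

definition homotopical_category :: "('o, 'm) cat \<Rightarrow> 'm set \<Rightarrow> bool" where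
  "homotopical_category C W \<longleftrightarrow> weq_category C W \<and> weak_invertibility C W"

inductive_set compositions :: "('o, 'm) cat \<Rightarrow> 'm set \<Rightarrow> 'm set"
  for C S where
  single: "f \<in> S \<Longrightarrow> f \<in> compositions C S"
| comp: "\<lbrakk>f \<in> S; g \<in> compositions C S; Dom C g = Cod C f\<rbrakk> \<Longrightarrow> g \<cdot>\<^bsub>C\<^esub> f \<in> compositions C S"

definition split_generated :: "('o, 'm) cat \<Rightarrow> 'm set \<Rightarrow> bool" where
  "split_generated C W \<longleftrightarrow> W \<subseteq> compositions C {w \<in> W. is_section C w \<or> is_retraction C w}"


section \<open>The localization\<close>

text \<open>
  An arrow \<open>X \<rightarrow> Y\<close> of the localization is a class of zigzags from \<open>X\<close> to \<open>Y\<close>: lists of steps, read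
  from \<open>X\<close> to \<open>Y\<close>, each of which is an arrow taken forwards or a weak equivalence taken backwards.
  Classes are taken for the least congruence that makes forward steps functorial and makes
  the backward step along a weak equivalence inverse to the forward one. The endpoints are kept in
  the arrow \<open>(X, class, Y)\<close>. Theorem \<open>localization\<close> below is the universal property.
\<close>

datatype 'm step = Fwd 'm | Bwd 'm

inductive zigzag :: "('o, 'm) cat \<Rightarrow> 'm set \<Rightarrow> 'o \<Rightarrow> 'o \<Rightarrow> 'm step list \<Rightarrow> bool"
  for C W where
  Nil: "X \<in> Obj C \<Longrightarrow> zigzag C W X X []"
| Fwd: "\<lbrakk>f \<in> hom C X Y; zigzag C W Y Z p\<rbrakk> \<Longrightarrow> zigzag C W X Z (Fwd f # p)"
| Bwd: "\<lbrakk>w \<in> W; w \<in> hom C Y X; zigzag C W Y Z p\<rbrakk> \<Longrightarrow> zigzag C W X Z (Bwd w # p)"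

inductive zeq :: "('o, 'm) cat \<Rightarrow> 'm set \<Rightarrow> 'o \<Rightarrow> 'o \<Rightarrow> 'm step list \<Rightarrow> 'm step list \<Rightarrow> bool"
  for C W where
  refl: "zigzag C W X Y p \<Longrightarrow> zeq C W X Y p p"
| sym: "zeq C W X Y p q \<Longrightarrow> zeq C W X Y q p"
| trans: "\<lbrakk>zeq C W X Y p q; zeq C W X Y q r\<rbrakk> \<Longrightarrow> zeq C W X Y p r"
| append: "\<lbrakk>zeq C W X Y p p'; zeq C W Y Z q q'\<rbrakk> \<Longrightarrow> zeq C W X Z (p @ q) (p' @ q')"
| Ident: "X \<in> Obj C \<Longrightarrow> zeq C W X X [Fwd (Ident C X)] []"
| Comp: "\<lbrakk>f \<in> hom C X Y; g \<in> hom C Y Z\<rbrakk> \<Longrightarrow> zeq C W X Z [Fwd f, Fwd g] [Fwd (g \<cdot>\<^bsub>C\<^esub> f)]"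
| Fwd_Bwd: "\<lbrakk>w \<in> W; w \<in> hom C X Y\<rbrakk> \<Longrightarrow> zeq C W X X [Fwd w, Bwd w] []"
| Bwd_Fwd: "\<lbrakk>w \<in> W; w \<in> hom C X Y\<rbrakk> \<Longrightarrow> zeq C W Y Y [Bwd w, Fwd w] []"

type_synonym ('o, 'm) ho_arr = "'o \<times> 'm step list set \<times> 'o"

definition zclass :: "('o, 'm) cat \<Rightarrow> 'm set \<Rightarrow> 'o \<Rightarrow> 'o \<Rightarrow> 'm step list \<Rightarrow> ('o, 'm) ho_arr" where
  "zclass C W X Y p = (X, {q. zeq C W X Y p q}, Y)"

definition Ho :: "('o, 'm) cat \<Rightarrow> 'm set \<Rightarrow> ('o, ('o, 'm) ho_arr) cat" where
  "Ho C W = \<lparr>Obj = Obj C,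
     Arr = {zclass C W X Y p | X Y p. zigzag C W X Y p},
     Dom = fst,
     Cod = (\<lambda>(X, P, Y). Y),
     Ident = (\<lambda>X. zclass C W X X []),
     Comp = (\<lambda>(Y, Q, Z) (X, P, Y'). (X, {r. \<exists>p\<in>P. \<exists>q\<in>Q. zeq C W X Z (p @ q) r}, Z))\<rparr>"

text \<open>The localization functor is \<open>\<gamma>\<close> on arrows and the identity on objects.\<close>

definition \<gamma> :: "('o, 'm) cat \<Rightarrow> 'm set \<Rightarrow> 'm \<Rightarrow> ('o, 'm) ho_arr" where
  "\<gamma> C W f = zclass C W (Dom C f) (Cod C f) [Fwd f]"

definition saturated :: "('o, 'm) cat \<Rightarrow> 'm set \<Rightarrow> bool" where
  "saturated C W \<longleftrightarrow> (\<forall>f \<in> Arr C. isomorphism (Ho C W) (\<gamma> C W f) \<longrightarrow> f \<in> W)"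


subsection \<open>Universal property\<close>

text \<open>The type argument gives the types of objects and arrows of the test categories \<open>E\<close>.\<close>

definition is_localization ::
  "('p, 'n) cat itself \<Rightarrow> ('o, 'm) cat \<Rightarrow> 'm set \<Rightarrow> ('q, 'l) cat \<Rightarrow> ('o \<Rightarrow> 'q) \<Rightarrow> ('m \<Rightarrow> 'l) \<Rightarrow> bool"
  where
  "is_localization _ C W H Lo La \<longleftrightarrow>
     category H \<and> is_functor C H Lo La \<and> (\<forall>w \<in> W. isomorphism H (La w)) \<and>
     (\<forall>(E :: ('p, 'n) cat) Fo Fa.
        category E \<and> is_functor C E Fo Fa \<and> (\<forall>w \<in> W. isomorphism E (Fa w)) \<longrightarrow>
        (\<exists>Go Ga. is_functor H E Go Ga \<and>
           (\<forall>X \<in> Obj C. Go (Lo X) = Fo X) \<and> (\<forall>f \<in> Arr C. Ga (La f) = Fa f) \<and>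
           (\<forall>Go' Ga'. is_functor H E Go' Ga' \<and>
              (\<forall>X \<in> Obj C. Go' (Lo X) = Fo X) \<and> (\<forall>f \<in> Arr C. Ga' (La f) = Fa f) \<longrightarrow>
              (\<forall>X \<in> Obj H. Go' X = Go X) \<and> (\<forall>f \<in> Arr H. Ga' f = Ga f))))"

lemma zigzag_Obj:
  assumes "category C" "zigzag C W X Y p"
  shows "X \<in> Obj C \<and> Y \<in> Obj C"
  using assms(2)
  by induction (auto simp: hom_def intro: category.Dom_Obj[OF assms(1)] category.Cod_Obj[OF assms(1)])

lemma zigzag_append:
  "zigzag C W X Y p \<Longrightarrow> zigzag C W Y Z q \<Longrightarrow> zigzag C W X Z (p @ q)"
  by (induction rule: zigzag.induct) (auto intro: zigzag.intros)

lemma zigzag_Fwd1: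
  assumes "category C" "f \<in> hom C X Y"
  shows "zigzag C W X Y [Fwd f]"
  using assms by (auto intro!: zigzag.intros simp: hom_def category.Cod_Obj)

lemma zigzag_Bwd1:
  assumes "category C" "w \<in> W" "w \<in> hom C X Y"
  shows "zigzag C W Y X [Bwd w]"
  using assms by (auto intro!: zigzag.intros simp: hom_def category.Dom_Obj)

lemma hom_Ident: "category C \<Longrightarrow> X \<in> Obj C \<Longrightarrow> Ident C X \<in> hom C X X"
  by (simp add: hom_def category.Ident_Arr category.Dom_Ident category.Cod_Ident)

lemma hom_Comp: "category C \<Longrightarrow> f \<in> hom C X Y \<Longrightarrow> g \<in> hom C Y Z \<Longrightarrow> g \<cdot>\<^bsub>C\<^esub> f \<in> hom C X Z"
  by (simp add: hom_def category.Comp_Arr category.Dom_Comp category.Cod_Comp)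

lemma hom_Obj: "category C \<Longrightarrow> f \<in> hom C X Y \<Longrightarrow> X \<in> Obj C \<and> Y \<in> Obj C"
  by (auto simp: hom_def category.Dom_Obj category.Cod_Obj)

lemma zeq_zigzag:
  assumes "category C" "zeq C W X Y p q"
  shows "zigzag C W X Y p \<and> zigzag C W X Y q"
  using assms(2)
proof induction
  case (Comp f X Y g Z)
  show ?case
    using zigzag_append[OF zigzag_Fwd1[OF assms(1) Comp(1)] zigzag_Fwd1[OF assms(1) Comp(2)]]
      zigzag_Fwd1[OF assms(1) hom_Comp[OF assms(1) Comp]] by simp
next
  case (Fwd_Bwd w X Y)
  show ?case
    using zigzag_append[OF zigzag_Fwd1[OF assms(1) Fwd_Bwd(2)] zigzag_Bwd1[OF assms(1) Fwd_Bwd]]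
      hom_Obj[OF assms(1) Fwd_Bwd(2)] by (simp add: zigzag.Nil)
next
  case (Bwd_Fwd w X Y)
  show ?case
    using zigzag_append[OF zigzag_Bwd1[OF assms(1) Bwd_Fwd] zigzag_Fwd1[OF assms(1) Bwd_Fwd(2)]]
      hom_Obj[OF assms(1) Bwd_Fwd(2)] by (simp add: zigzag.Nil)
qed (auto intro: zigzag_append zigzag.Nil zigzag_Fwd1[OF assms(1)] hom_Ident[OF assms(1)])

lemma zclass_eq:
  assumes "zigzag C W X Y p" "zigzag C W X' Y' p'"
  shows "zclass C W X Y p = zclass C W X' Y' p' \<longleftrightarrow> X = X' \<and> Y = Y' \<and> zeq C W X Y p p'"
proof -
  have "{q. zeq C W X Y p q} = {q. zeq C W X Y p' q} \<longleftrightarrow> zeq C W X Y p p'"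
    if "zigzag C W X Y p'"
  proof
    assume "{q. zeq C W X Y p q} = {q. zeq C W X Y p' q}"
    then show "zeq C W X Y p p'" using zeq.refl[OF that] by blast
  next
    assume e: "zeq C W X Y p p'"
    show "{q. zeq C W X Y p q} = {q. zeq C W X Y p' q}"
      using zeq.trans[OF e] zeq.trans[OF zeq.sym[OF e]] by blast
  qed
  then show ?thesis using assms(2) by (auto simp: zclass_def)
qed

lemma Comp_zclass:
  assumes "zigzag C W X Y p" "zigzag C W Y Z q"
  shows "zclass C W Y Z q \<cdot>\<^bsub>Ho C W\<^esub> zclass C W X Y p = zclass C W X Z (p @ q)"
proof -
  have "zeq C W X Z (p @ q) r"
    if "zeq C W X Y p p'" "zeq C W Y Z q q'" "zeq C W X Z (p' @ q') r" for p' q' r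
    by (rule zeq.trans[OF zeq.append[OF that(1,2)] that(3)])
  moreover have "zeq C W X Y p p" "zeq C W Y Z q q"
    using assms by (simp_all add: zeq.refl)
  ultimately have "{r. \<exists>p'\<in>{p'. zeq C W X Y p p'}. \<exists>q'\<in>{q'. zeq C W Y Z q q'}. zeq C W X Z (p' @ q') r}
      = {r. zeq C W X Z (p @ q) r}"
    by blast
  then show ?thesis by (simp add: Ho_def zclass_def)
qed

lemma Ho_simps [simp]:
  "Obj (Ho C W) = Obj C"
  "Dom (Ho C W) (zclass C W X Y p) = X"
  "Cod (Ho C W) (zclass C W X Y p) = Y"
  "Ident (Ho C W) X = zclass C W X X []"
  by (simp_all add: Ho_def zclass_def)

lemma zclass_Arr: "zigzag C W X Y p \<Longrightarrow> zclass C W X Y p \<in> Arr (Ho C W)"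
  by (auto simp: Ho_def)

lemma Ho_ArrE:
  assumes "f \<in> Arr (Ho C W)"
  obtains X Y p where "f = zclass C W X Y p" "zigzag C W X Y p"
  using assms by (auto simp: Ho_def)

lemma category_Ho:
  assumes C: "category C"
  shows "category (Ho C W)"
proof
  fix f g h
  assume f: "f \<in> Arr (Ho C W)" and g: "g \<in> Arr (Ho C W)" and h: "h \<in> Arr (Ho C W)"
    and gf: "Dom (Ho C W) g = Cod (Ho C W) f" and hg: "Dom (Ho C W) h = Cod (Ho C W) g"
  obtain X Y p where p: "f = zclass C W X Y p" "zigzag C W X Y p" using f by (rule Ho_ArrE)
  obtain Y' Z q where q: "g = zclass C W Y' Z q" "zigzag C W Y' Z q" using g by (rule Ho_ArrE)
  obtain Z' V r where r: "h = zclass C W Z' V r" "zigzag C W Z' V r" using h by (rule Ho_ArrE)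
  show "h \<cdot>\<^bsub>Ho C W\<^esub> (g \<cdot>\<^bsub>Ho C W\<^esub> f) = h \<cdot>\<^bsub>Ho C W\<^esub> g \<cdot>\<^bsub>Ho C W\<^esub> f"
    using p q r gf hg by (simp add: Comp_zclass zigzag_append)
next
  fix f g
  assume f: "f \<in> Arr (Ho C W)" and g: "g \<in> Arr (Ho C W)" and gf: "Dom (Ho C W) g = Cod (Ho C W) f"
  obtain X Y p where p: "f = zclass C W X Y p" "zigzag C W X Y p" using f by (rule Ho_ArrE)
  obtain Y' Z q where q: "g = zclass C W Y' Z q" "zigzag C W Y' Z q" using g by (rule Ho_ArrE)
  show "g \<cdot>\<^bsub>Ho C W\<^esub> f \<in> Arr (Ho C W)"
    "Dom (Ho C W) (g \<cdot>\<^bsub>Ho C W\<^esub> f) = Dom (Ho C W) f"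
    "Cod (Ho C W) (g \<cdot>\<^bsub>Ho C W\<^esub> f) = Cod (Ho C W) g"
    using p q gf by (simp_all add: Comp_zclass zigzag_append zclass_Arr)
next
  fix f
  assume f: "f \<in> Arr (Ho C W)"
  obtain X Y p where p: "f = zclass C W X Y p" "zigzag C W X Y p" using f by (rule Ho_ArrE)
  have XY: "X \<in> Obj C" "Y \<in> Obj C" using zigzag_Obj[OF C p(2)] by auto
  show "Dom (Ho C W) f \<in> Obj (Ho C W)" "Cod (Ho C W) f \<in> Obj (Ho C W)"
    using p XY by simp_all
  show "f \<cdot>\<^bsub>Ho C W\<^esub> Ident (Ho C W) (Dom (Ho C W) f) = f"
    "Ident (Ho C W) (Cod (Ho C W) f) \<cdot>\<^bsub>Ho C W\<^esub> f = f"
    using p XY by (simp_all add: Comp_zclass zigzag.Nil)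
next
  fix X
  assume "X \<in> Obj (Ho C W)"
  then show "Ident (Ho C W) X \<in> Arr (Ho C W)"
    "Dom (Ho C W) (Ident (Ho C W) X) = X" "Cod (Ho C W) (Ident (Ho C W) X) = X"
    by (simp_all add: zclass_Arr zigzag.Nil)
qed

lemma functor_\<gamma>:
  assumes C: "category C"
  shows "is_functor C (Ho C W) (\<lambda>X. X) (\<gamma> C W)"
  unfolding is_functor_def
proof (intro conjI ballI impI)
  fix X assume X: "X \<in> Obj C"
  then show "X \<in> Obj (Ho C W)" by simp
  show "\<gamma> C W (Ident C X) = Ident (Ho C W) X"
    using X by (simp add: \<gamma>_def category.Dom_Ident[OF C] category.Cod_Ident[OF C]
        zclass_eq zigzag_Fwd1[OF C hom_Ident[OF C]] zigzag.Nil zeq.Ident)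
next
  fix f assume "f \<in> Arr C"
  then have "zigzag C W (Dom C f) (Cod C f) [Fwd f]"
    by (intro zigzag_Fwd1[OF C]) (simp add: hom_def)
  then show "\<gamma> C W f \<in> hom (Ho C W) (Dom C f) (Cod C f)"
    by (simp add: \<gamma>_def hom_def zclass_Arr)
next
  fix f g assume "f \<in> Arr C" "g \<in> Arr C" "Dom C g = Cod C f"
  then have f: "f \<in> hom C (Dom C f) (Cod C f)" and g: "g \<in> hom C (Cod C f) (Cod C g)"
    by (simp_all add: hom_def)
  note gf = hom_Comp[OF C f g]
  have "zeq C W (Dom C f) (Cod C g) [Fwd (g \<cdot>\<^bsub>C\<^esub> f)] [Fwd f, Fwd g]"
    by (rule zeq.sym[OF zeq.Comp[OF f g]])
  then show "\<gamma> C W (g \<cdot>\<^bsub>C\<^esub> f) = \<gamma> C W g \<cdot>\<^bsub>Ho C W\<^esub> \<gamma> C W f"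
    using gf g zigzag_Fwd1[OF C f, of W] zigzag_Fwd1[OF C g, of W] zigzag_Fwd1[OF C gf, of W]
      zigzag_append[OF zigzag_Fwd1[OF C f, of W] zigzag_Fwd1[OF C g, of W]]
    by (simp add: \<gamma>_def Comp_zclass zclass_eq hom_def)
qed

lemma \<gamma>_inverse:
  assumes C: "category C" and w: "w \<in> W" "w \<in> Arr C"
  shows "inverse_arrows (Ho C W) (\<gamma> C W w) (zclass C W (Cod C w) (Dom C w) [Bwd w])"
proof -
  have h: "w \<in> hom C (Dom C w) (Cod C w)" using w by (simp add: hom_def)
  note zz = zigzag_Fwd1[OF C h, of W] zigzag_Bwd1[OF C w(1) h]
  have "zigzag C W (Dom C w) (Dom C w) [Fwd w, Bwd w]" "zigzag C W (Cod C w) (Cod C w) [Bwd w, Fwd w]"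
    using zigzag_append[OF zz] zigzag_append[OF zz(2,1)] by simp_all
  then show ?thesis
    using zz zeq.Fwd_Bwd[OF w(1) h] zeq.Bwd_Fwd[OF w(1) h] hom_Obj[OF C h]
    by (simp add: inverse_arrows_def \<gamma>_def hom_def zclass_Arr Comp_zclass zclass_eq zigzag.Nil)
qed

definition the_inverse_arrow :: "('o, 'm) cat \<Rightarrow> 'm \<Rightarrow> 'm" where
  "the_inverse_arrow C f = (SOME g. inverse_arrows C f g)"

fun zz_eval :: "('o, 'm) cat \<Rightarrow> ('p, 'n) cat \<Rightarrow> ('o \<Rightarrow> 'p) \<Rightarrow> ('m \<Rightarrow> 'n) \<Rightarrow> 'o \<Rightarrow> 'm step list \<Rightarrow> 'n" where
  "zz_eval C E Fo Fa X [] = Ident E (Fo X)"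
| "zz_eval C E Fo Fa X (Fwd f # p) = zz_eval C E Fo Fa (Cod C f) p \<cdot>\<^bsub>E\<^esub> Fa f"
| "zz_eval C E Fo Fa X (Bwd w # p) =
     zz_eval C E Fo Fa (Dom C w) p \<cdot>\<^bsub>E\<^esub> the_inverse_arrow E (Fa w)"

lemma inverse_arrows_unique:
  assumes "category E" "inverse_arrows E f g" "inverse_arrows E f h"
  shows "g = h"
proof -
  interpret category E by fact
  have "g = g \<cdot>\<^bsub>E\<^esub> (f \<cdot>\<^bsub>E\<^esub> h)"
    using assms Comp_Ident[of g] by (auto simp: inverse_arrows_def hom_def)
  also have "\<dots> = g \<cdot>\<^bsub>E\<^esub> f \<cdot>\<^bsub>E\<^esub> h"
    using assms by (intro Comp_assoc) (auto simp: inverse_arrows_def hom_def)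
  also have "\<dots> = h"
    using assms Ident_Comp[of h] by (auto simp: inverse_arrows_def hom_def)
  finally show ?thesis .
qed

context
  fixes C :: "('o, 'm) cat" and W and E :: "('p, 'n) cat" and Fo Fa
  assumes C: "category C" and E: "category E" and F: "is_functor C E Fo Fa"
    and inv: "\<forall>w \<in> W. isomorphism E (Fa w)"
begin

private abbreviation "ev \<equiv> zz_eval C E Fo Fa"
private abbreviation "iv w \<equiv> the_inverse_arrow E (Fa w)"

private lemma F_hom: "f \<in> hom C X Y \<Longrightarrow> Fa f \<in> hom E (Fo X) (Fo Y)"
  using F by (auto simp: is_functor_def hom_def)

private lemma iv: "w \<in> W \<Longrightarrow> inverse_arrows E (Fa w) (iv w)"
  using inv by (auto simp: isomorphism_def the_inverse_arrow_def intro: someI)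

private lemma iv_hom:
  assumes "w \<in> W" "w \<in> hom C X Y" shows "iv w \<in> hom E (Fo Y) (Fo X)"
  using iv[OF assms(1)] F_hom[OF assms(2)] by (auto simp: inverse_arrows_def hom_def)

private lemma E_assoc:
  "f \<in> hom E X Y \<Longrightarrow> g \<in> hom E Y Z \<Longrightarrow> h \<in> hom E Z V \<Longrightarrow> h \<cdot>\<^bsub>E\<^esub> (g \<cdot>\<^bsub>E\<^esub> f) = h \<cdot>\<^bsub>E\<^esub> g \<cdot>\<^bsub>E\<^esub> f"
  using category.Comp_assoc[OF E] by (auto simp: hom_def)

private lemma E_units:
  "f \<in> hom E X Y \<Longrightarrow> f \<cdot>\<^bsub>E\<^esub> Ident E X = f" "f \<in> hom E X Y \<Longrightarrow> Ident E Y \<cdot>\<^bsub>E\<^esub> f = f"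
  using category.Comp_Ident[OF E] category.Ident_Comp[OF E] by (auto simp: hom_def)

private lemma ev_hom: "zigzag C W X Y p \<Longrightarrow> ev X p \<in> hom E (Fo X) (Fo Y)"
proof (induction rule: zigzag.induct)
  case (Nil X)
  then show ?case using F hom_Ident[OF E] by (simp add: is_functor_def)
next
  case (Fwd f X Y Z p)
  then show ?case using hom_Comp[OF E F_hom[OF Fwd(1)] Fwd.IH] by (simp add: hom_def)
next
  case (Bwd w Y X Z p)
  then show ?case using hom_Comp[OF E iv_hom[OF Bwd(1,2)] Bwd.IH] by (simp add: hom_def)
qed

private lemma ev_append:
  assumes "zigzag C W X Y p" "zigzag C W Y Z q"
  shows "ev X (p @ q) = ev Y q \<cdot>\<^bsub>E\<^esub> ev X p"
  using assms
proof (induction rule: zigzag.induct)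
  case (Nil X)
  then show ?case using E_units(1)[OF ev_hom] by simp
next
  case (Fwd f X Y Z' p)
  then show ?case
    using E_assoc[OF F_hom[OF Fwd(1)] ev_hom[OF Fwd(2)] ev_hom[OF Fwd.prems]]
    by (auto simp: hom_def)
next
  case (Bwd w Y X Z' p)
  then show ?case
    using E_assoc[OF iv_hom[OF Bwd(1,2)] ev_hom[OF Bwd(3)] ev_hom[OF Bwd.prems]]
    by (auto simp: hom_def)
qed

private lemma ev_Fwd1: "f \<in> hom C X Y \<Longrightarrow> ev X [Fwd f] = Fa f"
  using E_units(2)[OF F_hom] by (auto simp: hom_def)

private lemma ev_Bwd1:
  assumes "w \<in> W" "w \<in> hom C X Y" shows "ev Y [Bwd w] = iv w"
  using E_units(2)[OF iv_hom[OF assms]] assms by (auto simp: hom_def)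

private lemma ev_zeq: "zeq C W X Y p q \<Longrightarrow> ev X p = ev X q"
proof (induction rule: zeq.induct)
  case (append X Y p p' Z q q')
  note zz = zeq_zigzag[OF C append(1)] zeq_zigzag[OF C append(2)]
  show ?case
    using ev_append[of X Y p Z q] ev_append[of X Y p' Z q'] zz append.IH by simp
next
  case (Ident X)
  then show ?case using ev_Fwd1[OF hom_Ident[OF C]] F by (simp add: is_functor_def)
next
  case (Comp f X Y g Z)
  have "ev X [Fwd f, Fwd g] = Fa g \<cdot>\<^bsub>E\<^esub> Fa f"
    using ev_append[OF zigzag_Fwd1[OF C Comp(1)] zigzag_Fwd1[OF C Comp(2)]]
      ev_Fwd1[OF Comp(1)] ev_Fwd1[OF Comp(2)] by simp
  then show ?case
    using Comp F ev_Fwd1[OF hom_Comp[OF C Comp]] by (simp add: is_functor_def hom_def)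
next
  case (Fwd_Bwd w X Y)
  have "ev X [Fwd w, Bwd w] = iv w \<cdot>\<^bsub>E\<^esub> Fa w"
    using ev_append[OF zigzag_Fwd1[OF C Fwd_Bwd(2)] zigzag_Bwd1[OF C Fwd_Bwd]]
      ev_Fwd1[OF Fwd_Bwd(2)] ev_Bwd1[OF Fwd_Bwd] by simp
  then show ?case
    using iv[OF Fwd_Bwd(1)] F_hom[OF Fwd_Bwd(2)] by (simp add: inverse_arrows_def hom_def)
next
  case (Bwd_Fwd w X Y)
  have "ev Y [Bwd w, Fwd w] = Fa w \<cdot>\<^bsub>E\<^esub> iv w"
    using ev_append[OF zigzag_Bwd1[OF C Bwd_Fwd] zigzag_Fwd1[OF C Bwd_Fwd(2)]]
      ev_Fwd1[OF Bwd_Fwd(2)] ev_Bwd1[OF Bwd_Fwd] by simp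
  then show ?case
    using iv[OF Bwd_Fwd(1)] F_hom[OF Bwd_Fwd(2)] by (simp add: inverse_arrows_def hom_def)
qed auto

private definition "lift = (\<lambda>(X, P, Y). ev X (SOME p. p \<in> P))"

private lemma lift_zclass:
  assumes "zigzag C W X Y p" shows "lift (zclass C W X Y p) = ev X p"
proof -
  have "zeq C W X Y p (SOME q. zeq C W X Y p q)"
    using zeq.refl[OF assms] by (rule someI)
  then show ?thesis by (simp add: lift_def zclass_def ev_zeq[symmetric])
qed

private lemma lift_functor: "is_functor (Ho C W) E Fo lift"
  unfolding is_functor_def
proof (intro conjI ballI impI)
  fix X assume "X \<in> Obj (Ho C W)"
  then show "Fo X \<in> Obj E" "lift (Ident (Ho C W) X) = Ident E (Fo X)"
    using F by (simp_all add: is_functor_def lift_zclass zigzag.Nil)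
next
  fix f assume "f \<in> Arr (Ho C W)"
  then show "lift f \<in> hom E (Fo (Dom (Ho C W) f)) (Fo (Cod (Ho C W) f))"
    by (auto elim!: Ho_ArrE simp: lift_zclass ev_hom)
next
  fix f g
  assume f: "f \<in> Arr (Ho C W)" and g: "g \<in> Arr (Ho C W)" and gf: "Dom (Ho C W) g = Cod (Ho C W) f"
  obtain X Y p where p: "f = zclass C W X Y p" "zigzag C W X Y p" using f by (rule Ho_ArrE)
  obtain Y' Z q where q: "g = zclass C W Y' Z q" "zigzag C W Y' Z q" using g by (rule Ho_ArrE)
  have "Y' = Y" using p q gf by simp
  then show "lift (g \<cdot>\<^bsub>Ho C W\<^esub> f) = lift g \<cdot>\<^bsub>E\<^esub> lift f"
    using p q ev_append[OF p(2), of Z q] by (simp add: lift_zclass Comp_zclass zigzag_append)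
qed

private lemma functor_zclass:
  assumes G: "is_functor (Ho C W) E Go Ga" and Go: "\<forall>X \<in> Obj C. Go X = Fo X"
    and Ga: "\<forall>f \<in> Arr C. Ga (\<gamma> C W f) = Fa f" and "zigzag C W X Y p"
  shows "Ga (zclass C W X Y p) = ev X p"
proof -
  have comp: "Ga (zclass C W X Z (p @ q)) = Ga (zclass C W Y Z q) \<cdot>\<^bsub>E\<^esub> Ga (zclass C W X Y p)"
    if "zigzag C W X Y p" "zigzag C W Y Z q" for X Y Z p q
    using G that by (simp add: is_functor_def zclass_Arr Comp_zclass[symmetric])
  from assms(4) show ?thesis
  proof (induction rule: zigzag.induct)
    case (Nil X)
    then show ?case using G Go by (simp add: is_functor_def)
  next
    case (Fwd f X Y Z p)
    then show ?case
      using comp[OF zigzag_Fwd1[OF C Fwd(1)] Fwd(2)] Ga by (auto simp: hom_def \<gamma>_def)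
  next
    case (Bwd w Y X Z p)
    then have w: "w \<in> Arr C" and X: "X = Cod C w" and Y: "Y = Dom C w" by (auto simp: hom_def)
    define b where "b = zclass C W X Y [Bwd w]"
    note i = \<gamma>_inverse[OF C Bwd(1) w, folded X Y, folded b_def]
    have arr: "\<gamma> C W w \<in> Arr (Ho C W)" "b \<in> Arr (Ho C W)"
      and dc: "Dom (Ho C W) (\<gamma> C W w) = Y" "Cod (Ho C W) (\<gamma> C W w) = X"
        "Dom (Ho C W) b = X" "Cod (Ho C W) b = Y"
      using i X Y by (auto simp: inverse_arrows_def hom_def \<gamma>_def)
    have XY: "X \<in> Obj C" "Y \<in> Obj C" using hom_Obj[OF C Bwd(2)] by auto
    have h: "Fa w \<in> hom E (Fo Y) (Fo X)" by (rule F_hom[OF Bwd(2)])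
    have "Ga b \<in> hom E (Fo X) (Fo Y)"
      using G arr dc Go XY by (auto simp: is_functor_def)
    moreover have "Ga b \<cdot>\<^bsub>E\<^esub> Fa w = Ident E (Fo Y)" "Fa w \<cdot>\<^bsub>E\<^esub> Ga b = Ident E (Fo X)"
    proof -
      have "Ga (b \<cdot>\<^bsub>Ho C W\<^esub> \<gamma> C W w) = Ga b \<cdot>\<^bsub>E\<^esub> Ga (\<gamma> C W w)"
        "Ga (\<gamma> C W w \<cdot>\<^bsub>Ho C W\<^esub> b) = Ga (\<gamma> C W w) \<cdot>\<^bsub>E\<^esub> Ga b"
        using G arr dc by (simp_all add: is_functor_def)
      moreover have "Ga (Ident (Ho C W) X) = Ident E (Fo X)" "Ga (Ident (Ho C W) Y) = Ident E (Fo Y)"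
        using G Go XY by (simp_all add: is_functor_def del: Ho_simps(4))
      ultimately show "Ga b \<cdot>\<^bsub>E\<^esub> Fa w = Ident E (Fo Y)" "Fa w \<cdot>\<^bsub>E\<^esub> Ga b = Ident E (Fo X)"
        using i Ga w dc by (simp_all add: inverse_arrows_def del: Ho_simps(4))
    qed
    ultimately have "inverse_arrows E (Fa w) (Ga b)"
      using h by (simp add: inverse_arrows_def hom_def)
    then have "Ga b = iv w"
      using inverse_arrows_unique[OF E _ iv[OF Bwd(1)]] by blast
    then show ?case
      using comp[OF zigzag_Bwd1[OF C Bwd(1,2)] Bwd(3)] Bwd.IH Y by (simp add: b_def)
  qed
qed

lemma Ho_factorization:
  "\<exists>Go Ga. is_functor (Ho C W) E Go Ga \<and>
     (\<forall>X \<in> Obj C. Go X = Fo X) \<and> (\<forall>f \<in> Arr C. Ga (\<gamma> C W f) = Fa f) \<and>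
     (\<forall>Go' Ga'. is_functor (Ho C W) E Go' Ga' \<and>
        (\<forall>X \<in> Obj C. Go' X = Fo X) \<and> (\<forall>f \<in> Arr C. Ga' (\<gamma> C W f) = Fa f) \<longrightarrow>
        (\<forall>X \<in> Obj (Ho C W). Go' X = Go X) \<and> (\<forall>f \<in> Arr (Ho C W). Ga' f = Ga f))"
proof (intro exI[of _ Fo] exI[of _ lift] conjI allI impI ballI)
  show "is_functor (Ho C W) E Fo lift" by (rule lift_functor)
next
  fix f assume "f \<in> Arr C"
  then have f: "f \<in> hom C (Dom C f) (Cod C f)" by (simp add: hom_def)
  then show "lift (\<gamma> C W f) = Fa f"
    unfolding \<gamma>_def lift_zclass[OF zigzag_Fwd1[OF C f]] by (rule ev_Fwd1)
next
  fix Go' Ga' f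
  assume G: "is_functor (Ho C W) E Go' Ga' \<and>
    (\<forall>X \<in> Obj C. Go' X = Fo X) \<and> (\<forall>f \<in> Arr C. Ga' (\<gamma> C W f) = Fa f)"
    and "f \<in> Arr (Ho C W)"
  then show "Ga' f = lift f"
    by (auto elim!: Ho_ArrE simp: lift_zclass functor_zclass)
qed auto

end

theorem localization:
  assumes "category C" "W \<subseteq> Arr C"
  shows "is_localization TYPE(('p, 'n) cat) C W (Ho C W) (\<lambda>X. X) (\<gamma> C W)"
  unfolding is_localization_def
proof (intro conjI ballI allI impI)
  fix w assume w: "w \<in> W"
  then have "w \<in> Arr C" using assms(2) by blast
  from \<gamma>_inverse[OF assms(1) w this] show "isomorphism (Ho C W) (\<gamma> C W w)"
    unfolding isomorphism_def by blast
next
  fix E :: "('p, 'n) cat" and Fo Fa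
  assume a: "category E \<and> is_functor C E Fo Fa \<and> (\<forall>w\<in>W. isomorphism E (Fa w))"
  show "\<exists>Go Ga. is_functor (Ho C W) E Go Ga \<and>
     (\<forall>X \<in> Obj C. Go X = Fo X) \<and> (\<forall>f \<in> Arr C. Ga (\<gamma> C W f) = Fa f) \<and>
     (\<forall>Go' Ga'. is_functor (Ho C W) E Go' Ga' \<and>
        (\<forall>X \<in> Obj C. Go' X = Fo X) \<and> (\<forall>f \<in> Arr C. Ga' (\<gamma> C W f) = Fa f) \<longrightarrow>
        (\<forall>X \<in> Obj (Ho C W). Go' X = Go X) \<and> (\<forall>f \<in> Arr (Ho C W). Ga' f = Ga f))"
    by (rule Ho_factorization[OF assms(1) conjunct1[OF a] conjunct1[OF conjunct2[OF a]]
          conjunct2[OF conjunct2[OF a]]])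
qed (use assms in \<open>simp_all add: category_Ho functor_\<gamma>\<close>)


section \<open>Deformations\<close>

text \<open>
  \<open>r\<close> takes values in the subcategory \<open>D\<close> on objects and on arrows. Subcategories need not be full;
  for a full one the condition on arrows follows from the condition on objects (lemma
  \<open>full_subcategory_functor\<close>). Without it the condition on objects alone would be satisfied by
  \<open>r = id\<close> and the subcategory of all identities.
\<close>

definition deformation_functor ::
  "('o, 'm) cat \<Rightarrow> 'm set \<Rightarrow> ('o, 'm) cat \<Rightarrow> ('o \<Rightarrow> 'o) \<Rightarrow> ('m \<Rightarrow> 'm) \<Rightarrow> bool" where
  "deformation_functor C W D ro ra \<longleftrightarrow>
     is_functor C C ro ra \<and> (\<forall>w \<in> W. ra w \<in> W) \<and>
     (\<forall>X \<in> Obj C. ro X \<in> Obj D) \<and> (\<forall>f \<in> Arr C. ra f \<in> Arr D)"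

definition left_deformation ::
  "('o, 'm) cat \<Rightarrow> 'm set \<Rightarrow> ('o, 'm) cat \<Rightarrow> ('o \<Rightarrow> 'o) \<Rightarrow> ('m \<Rightarrow> 'm) \<Rightarrow> ('o \<Rightarrow> 'm) \<Rightarrow> bool" where
  "left_deformation C W D ro ra \<theta> \<longleftrightarrow> deformation_functor C W D ro ra \<and>
     nat_transf C C ro ra (\<lambda>X. X) (\<lambda>f. f) \<theta> \<and> (\<forall>X \<in> Obj C. \<theta> X \<in> W)"

definition right_deformation ::
  "('o, 'm) cat \<Rightarrow> 'm set \<Rightarrow> ('o, 'm) cat \<Rightarrow> ('o \<Rightarrow> 'o) \<Rightarrow> ('m \<Rightarrow> 'm) \<Rightarrow> ('o \<Rightarrow> 'm) \<Rightarrow> bool" where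
  "right_deformation C W D ro ra \<theta> \<longleftrightarrow> deformation_functor C W D ro ra \<and>
     nat_transf C C (\<lambda>X. X) (\<lambda>f. f) ro ra \<theta> \<and> (\<forall>X \<in> Obj C. \<theta> X \<in> W)"

lemma full_subcategory_functor:
  assumes "is_functor C C ro ra" "\<forall>X \<in> Obj C. ro X \<in> Obj D"
    and "category C" "\<forall>X \<in> Obj D. \<forall>Y \<in> Obj D. hom D X Y = hom C X Y"
  shows "\<forall>f \<in> Arr C. ra f \<in> Arr D"
proof
  fix f assume f: "f \<in> Arr C"
  then have "ra f \<in> hom C (ro (Dom C f)) (ro (Cod C f))"
    using assms(1) by (simp add: is_functor_def)
  then have "ra f \<in> hom D (ro (Dom C f)) (ro (Cod C f))"
    using assms f by (simp add: category.Dom_Obj category.Cod_Obj)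
  then show "ra f \<in> Arr D" by (simp add: hom_def)
qed

definition deformable :: "('o, 'm) cat \<Rightarrow> 'm set \<Rightarrow> ('o, 'm) cat \<Rightarrow> bool" where
  "deformable C W C0 \<longleftrightarrow> (\<exists>(n::nat) D. n \<ge> 1 \<and> D 0 = C \<and> D n = C0 \<and>
     (\<forall>i<n. subcategory (D (Suc i)) (D i) \<and>
        (\<exists>ro ra \<theta>. left_deformation (D i) (W \<inter> Arr (D i)) (D (Suc i)) ro ra \<theta> \<or>
                   right_deformation (D i) (W \<inter> Arr (D i)) (D (Suc i)) ro ra \<theta>)))"


section \<open>The fork condition\<close>

definition left_fork ::
  "('o, 'm) cat \<Rightarrow> 'm set \<Rightarrow> 'o \<Rightarrow> 'o \<Rightarrow> 'm \<Rightarrow> 'm \<Rightarrow> 'o \<Rightarrow> 'o \<Rightarrow> 'm \<Rightarrow> 'm \<Rightarrow> 'm \<Rightarrow> 'm \<Rightarrow> 'm \<Rightarrow> bool" where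
  "left_fork C W A B f g K A' \<alpha> d\<^sub>0 d\<^sub>1 \<sigma> h \<longleftrightarrow>
     \<alpha> \<in> hom C A K \<and> d\<^sub>0 \<in> hom C A A' \<and> d\<^sub>1 \<in> hom C A A' \<and> \<sigma> \<in> hom C A' K \<and> h \<in> hom C A' B \<and>
     \<sigma> \<in> W \<and> \<sigma> \<cdot>\<^bsub>C\<^esub> d\<^sub>0 = \<alpha> \<and> \<sigma> \<cdot>\<^bsub>C\<^esub> d\<^sub>1 = \<alpha> \<and> h \<cdot>\<^bsub>C\<^esub> d\<^sub>0 = f \<and> h \<cdot>\<^bsub>C\<^esub> d\<^sub>1 = g"

definition right_fork ::
  "('o, 'm) cat \<Rightarrow> 'm set \<Rightarrow> 'o \<Rightarrow> 'o \<Rightarrow> 'm \<Rightarrow> 'm \<Rightarrow> 'o \<Rightarrow> 'o \<Rightarrow> 'm \<Rightarrow> 'm \<Rightarrow> 'm \<Rightarrow> 'm \<Rightarrow> 'm \<Rightarrow> bool" where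
  "right_fork C W A B f g K B' \<beta> d\<^sub>0 d\<^sub>1 s k \<longleftrightarrow>
     \<beta> \<in> hom C K B \<and> d\<^sub>0 \<in> hom C B' B \<and> d\<^sub>1 \<in> hom C B' B \<and> s \<in> hom C K B' \<and> k \<in> hom C A B' \<and>
     s \<in> W \<and> d\<^sub>0 \<cdot>\<^bsub>C\<^esub> s = \<beta> \<and> d\<^sub>1 \<cdot>\<^bsub>C\<^esub> s = \<beta> \<and> d\<^sub>0 \<cdot>\<^bsub>C\<^esub> k = f \<and> d\<^sub>1 \<cdot>\<^bsub>C\<^esub> k = g"

definition fork_condition :: "('o, 'm) cat \<Rightarrow> 'm set \<Rightarrow> bool" where
  "fork_condition C W \<longleftrightarrow> (\<forall>A \<in> Obj C. \<forall>B \<in> Obj C. \<forall>f \<in> hom C A B. \<forall>g \<in> hom C A B.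
     ((\<exists>K A' \<alpha> d\<^sub>0 d\<^sub>1 \<sigma> h. left_fork C W A B f g K A' \<alpha> d\<^sub>0 d\<^sub>1 \<sigma> h) \<longrightarrow>
      (\<exists>K A' \<alpha> d\<^sub>0 d\<^sub>1 \<sigma> h. left_fork C W A B f g K A' \<alpha> d\<^sub>0 d\<^sub>1 \<sigma> h \<and> \<alpha> \<in> W)) \<and>
     ((\<exists>K B' \<beta> d\<^sub>0 d\<^sub>1 s k. right_fork C W A B f g K B' \<beta> d\<^sub>0 d\<^sub>1 s k) \<longrightarrow>
      (\<exists>K B' \<beta> d\<^sub>0 d\<^sub>1 s k. right_fork C W A B f g K B' \<beta> d\<^sub>0 d\<^sub>1 s k \<and> \<beta> \<in> W)))"

end

theory Submission
  imports Defs
begin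

text \<open>
  Two independent facts combine: saturation of \<open>C\<^sub>0\<close>, and its transport back to \<open>C\<close>.

  Saturation of \<open>C\<^sub>0\<close>. Call \<open>u\<close> and \<open>v\<close> elementarily homotopic when \<open>u = h \<cdot> d\<^sub>0\<close> and
  \<open>v = h \<cdot> d\<^sub>1\<close> for some \<open>h\<close>, \<open>d\<^sub>0\<close>, \<open>d\<^sub>1\<close> such that some weak equivalence \<open>\<sigma>\<close> equalizes \<open>d\<^sub>0\<close> and
  \<open>d\<^sub>1\<close>. This relation is symmetric and stable under composition on both sides, so its reflexive
  transitive closure is a congruence. If \<open>w\<close> is a weak equivalence and \<open>r \<cdot> w\<close> is an identity, then
  \<open>r\<close> is a weak equivalence equalizing \<open>w \<cdot> r\<close> and the identity, so that these two are homotopic; a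
  split weak equivalence is therefore invertible in the quotient by the congruence
  (\<open>section_homotopy_inverse\<close>). When all weak equivalences are composites of split ones, the
  quotient inverts all of them, and the universal property of the localization yields a functor
  from the localization to the quotient. Hence an arrow \<open>f\<close> that becomes invertible in the
  localization has a homotopy inverse \<open>g\<close> in the category itself (\<open>homotopy_inverse_exists\<close>).
  By the fork condition \<open>\<alpha> = \<sigma> \<cdot> d\<^sub>0 = \<sigma> \<cdot> d\<^sub>1\<close> can be taken to be a weak equivalence too. Then so are
  \<open>d\<^sub>0\<close> and \<open>d\<^sub>1\<close>, and \<open>u\<close> and \<open>v\<close> are weak equivalences exactly when \<open>h\<close> is: being a weak
  equivalence is invariant under homotopy (\<open>homotopic_weq_iff\<close>). So \<open>g \<cdot> f\<close> and \<open>f \<cdot> g\<close>, which are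
  homotopic to identities, are weak equivalences, and weak invertibility gives \<open>f \<in> W\<close>.

  Transport. A deformation \<open>r\<close> of \<open>C\<close> into \<open>D\<close> preserves weak equivalences, so it induces a functor
  between the localizations. If \<open>\<gamma> f\<close> is invertible, so is the image of \<open>r f\<close> in the localization of
  \<open>D\<close>, and \<open>r f\<close> is a weak equivalence when \<open>D\<close> is saturated. As \<open>f\<close> is linked to \<open>r f\<close> by a
  naturality square with two sides in \<open>W\<close>, it is a weak equivalence (\<open>saturated_of_deformation\<close>).
  Induction along the sequence of deformations gives the theorem.
\<close>

section \<open>Isomorphisms and functors\<close>

lemma comp_assoc_hom:
  "\<lbrakk>category C; f \<in> hom C X Y; g \<in> hom C Y Z; h \<in> hom C Z V\<rbrakk>
    \<Longrightarrow> h \<cdot>\<^bsub>C\<^esub> (g \<cdot>\<^bsub>C\<^esub> f) = h \<cdot>\<^bsub>C\<^esub> g \<cdot>\<^bsub>C\<^esub> f"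
  by (auto simp: hom_def intro: category.Comp_assoc)

lemma comp_Ident_hom: "category C \<Longrightarrow> f \<in> hom C X Y \<Longrightarrow> f \<cdot>\<^bsub>C\<^esub> Ident C X = f"
  by (auto simp: hom_def category.Comp_Ident)

lemma Ident_comp_hom: "category C \<Longrightarrow> f \<in> hom C X Y \<Longrightarrow> Ident C Y \<cdot>\<^bsub>C\<^esub> f = f"
  by (auto simp: hom_def category.Ident_Comp)

lemma functor_hom: "is_functor C D Fo Fa \<Longrightarrow> f \<in> hom C X Y \<Longrightarrow> Fa f \<in> hom D (Fo X) (Fo Y)"
  by (auto simp: is_functor_def hom_def)

lemma functor_comp:
  "is_functor C D Fo Fa \<Longrightarrow> f \<in> hom C X Y \<Longrightarrow> g \<in> hom C Y Z \<Longrightarrow> Fa (g \<cdot>\<^bsub>C\<^esub> f) = Fa g \<cdot>\<^bsub>D\<^esub> Fa f"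
  by (auto simp: is_functor_def hom_def)

lemma isomorphism_hom_iff:
  "f \<in> hom C X Y \<Longrightarrow> isomorphism C f \<longleftrightarrow>
     (\<exists>g \<in> hom C Y X. g \<cdot>\<^bsub>C\<^esub> f = Ident C X \<and> f \<cdot>\<^bsub>C\<^esub> g = Ident C Y)"
  by (auto simp: isomorphism_def inverse_arrows_def hom_def)

lemma isomorphism_comp:
  assumes C: "category C" and f: "f \<in> hom C X Y" and g: "g \<in> hom C Y Z"
    and "isomorphism C f" "isomorphism C g"
  shows "isomorphism C (g \<cdot>\<^bsub>C\<^esub> f)"
proof -
  obtain f' where f': "f' \<in> hom C Y X" "f' \<cdot>\<^bsub>C\<^esub> f = Ident C X" "f \<cdot>\<^bsub>C\<^esub> f' = Ident C Y"
    using assms isomorphism_hom_iff[OF f] by blast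
  obtain g' where g': "g' \<in> hom C Z Y" "g' \<cdot>\<^bsub>C\<^esub> g = Ident C Y" "g \<cdot>\<^bsub>C\<^esub> g' = Ident C Z"
    using assms isomorphism_hom_iff[OF g] by blast
  note gf = hom_Comp[OF C f g] and fg' = hom_Comp[OF C g'(1) f'(1)]
  have "f' \<cdot>\<^bsub>C\<^esub> g' \<cdot>\<^bsub>C\<^esub> (g \<cdot>\<^bsub>C\<^esub> f) = f' \<cdot>\<^bsub>C\<^esub> (g' \<cdot>\<^bsub>C\<^esub> g \<cdot>\<^bsub>C\<^esub> f)"
    using comp_assoc_hom[OF C gf g'(1) f'(1)] comp_assoc_hom[OF C f g g'(1)] by simp
  also have "\<dots> = Ident C X" using f' g' Ident_comp_hom[OF C f] by simp
  finally have 1: "f' \<cdot>\<^bsub>C\<^esub> g' \<cdot>\<^bsub>C\<^esub> (g \<cdot>\<^bsub>C\<^esub> f) = Ident C X" .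
  have "g \<cdot>\<^bsub>C\<^esub> f \<cdot>\<^bsub>C\<^esub> (f' \<cdot>\<^bsub>C\<^esub> g') = g \<cdot>\<^bsub>C\<^esub> (f \<cdot>\<^bsub>C\<^esub> f' \<cdot>\<^bsub>C\<^esub> g')"
    using comp_assoc_hom[OF C fg' f g] comp_assoc_hom[OF C g'(1) f'(1) f] by simp
  also have "\<dots> = Ident C Z" using f' g' Ident_comp_hom[OF C g'(1)] by simp
  finally show ?thesis
    using 1 fg' isomorphism_hom_iff[OF gf] by blast
qed

lemma functor_isomorphism:
  assumes C: "category C" and F: "is_functor C D Fo Fa" and iso: "isomorphism C f"
  shows "isomorphism D (Fa f)"
proof -
  obtain g where "inverse_arrows C f g" using iso by (auto simp: isomorphism_def)
  then have f: "f \<in> hom C (Dom C f) (Cod C f)" and g: "g \<in> hom C (Cod C f) (Dom C f)"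
    and gf: "g \<cdot>\<^bsub>C\<^esub> f = Ident C (Dom C f)" "f \<cdot>\<^bsub>C\<^esub> g = Ident C (Cod C f)"
    by (auto simp: inverse_arrows_def hom_def)
  have "Fa g \<cdot>\<^bsub>D\<^esub> Fa f = Ident D (Fo (Dom C f))" "Fa f \<cdot>\<^bsub>D\<^esub> Fa g = Ident D (Fo (Cod C f))"
    using functor_comp[OF F f g] functor_comp[OF F g f] gf hom_Obj[OF C f] F
    by (simp_all add: is_functor_def)
  then show ?thesis
    using isomorphism_hom_iff[OF functor_hom[OF F f]] functor_hom[OF F g] by blast
qed

lemma functor_compose:
  assumes "is_functor C D Fo Fa" "is_functor D E Go Ga"
  shows "is_functor C E (\<lambda>X. Go (Fo X)) (\<lambda>f. Ga (Fa f))"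
  using assms by (auto simp: is_functor_def hom_def)

text \<open>
  This is how the universal property of the localization is used below: invertibility in the
  localization is the strongest form of invertibility under functors that invert \<open>W\<close>.
\<close>

lemma isomorphism_of_localized_isomorphism:
  fixes E :: "('p, 'n) cat"
  assumes C: "category C" and W: "W \<subseteq> Arr C" and E: "category E" and F: "is_functor C E Fo Fa"
    and inv: "\<forall>w \<in> W. isomorphism E (Fa w)"
    and f: "f \<in> Arr C" "isomorphism (Ho C W) (\<gamma> C W f)"
  shows "isomorphism E (Fa f)"
proof -
  obtain Go Ga where "is_functor (Ho C W) E Go Ga" and Ga: "\<forall>f \<in> Arr C. Ga (\<gamma> C W f) = Fa f"
    using Ho_factorization[OF C E F inv] by blast
  then show ?thesis
    using functor_isomorphism[OF category_Ho[OF C] _ f(2)] f(1) by fastforce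
qed


section \<open>Weak equivalences and subcategories\<close>

lemma weq_two_out_of_three:
  assumes "weq_category C W" "f \<in> hom C X Y" "g \<in> hom C Y Z"
  shows "(f \<in> W \<and> g \<in> W \<longrightarrow> g \<cdot>\<^bsub>C\<^esub> f \<in> W) \<and>
    (f \<in> W \<and> g \<cdot>\<^bsub>C\<^esub> f \<in> W \<longrightarrow> g \<in> W) \<and> (g \<in> W \<and> g \<cdot>\<^bsub>C\<^esub> f \<in> W \<longrightarrow> f \<in> W)"
proof -
  have "f \<in> Arr C" "g \<in> Arr C" "Dom C g = Cod C f" using assms(2,3) by (auto simp: hom_def)
  then show ?thesis using assms(1) unfolding weq_category_def two_out_of_three_def by blast
qed

lemma subcategory_hom: "subcategory D C \<Longrightarrow> f \<in> hom D X Y \<Longrightarrow> f \<in> hom C X Y"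
  by (auto simp: subcategory_def hom_def)

lemma subcategory_refl: "category C \<Longrightarrow> subcategory C C"
  by (simp add: subcategory_def)

lemma subcategory_trans:
  assumes "subcategory E D" "subcategory D C"
  shows "subcategory E C"
proof -
  have "g \<cdot>\<^bsub>E\<^esub> f = g \<cdot>\<^bsub>C\<^esub> f" if "f \<in> Arr E" "g \<in> Arr E" "Dom E g = Cod E f" for f g
  proof -
    have "f \<in> Arr D" "g \<in> Arr D" "Dom D g = Cod D f" "g \<cdot>\<^bsub>E\<^esub> f = g \<cdot>\<^bsub>D\<^esub> f"
      using assms(1) that by (auto simp: subcategory_def)
    then show ?thesis using assms(2) by (simp add: subcategory_def)
  qed
  then show ?thesis using assms by (auto simp: subcategory_def)
qed

lemma weq_category_restrict:
  assumes "weq_category C W" "subcategory D C"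
  shows "weq_category D (W \<inter> Arr D)"
proof -
  have "two_out_of_three D (W \<inter> Arr D)"
    unfolding two_out_of_three_def
  proof (intro ballI impI)
    fix f g assume fg: "f \<in> Arr D" "g \<in> Arr D" "Dom D g = Cod D f"
    have "f \<in> hom D (Dom D f) (Cod D f)" "g \<in> hom D (Cod D f) (Cod D g)"
      using fg by (simp_all add: hom_def)
    then have "f \<in> hom C (Dom D f) (Cod D f)" "g \<in> hom C (Cod D f) (Cod D g)"
      using subcategory_hom[OF assms(2)] by blast+
    note two = weq_two_out_of_three[OF assms(1) this]
    have comp: "g \<cdot>\<^bsub>D\<^esub> f = g \<cdot>\<^bsub>C\<^esub> f"
      using assms(2) fg by (simp add: subcategory_def)
    have "g \<cdot>\<^bsub>D\<^esub> f \<in> Arr D"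
      using category.Comp_Arr[OF _ fg] assms(2) by (simp add: subcategory_def)
    then show "(f \<in> W \<inter> Arr D \<and> g \<in> W \<inter> Arr D \<longrightarrow> g \<cdot>\<^bsub>D\<^esub> f \<in> W \<inter> Arr D) \<and>
        (f \<in> W \<inter> Arr D \<and> g \<cdot>\<^bsub>D\<^esub> f \<in> W \<inter> Arr D \<longrightarrow> g \<in> W \<inter> Arr D) \<and>
        (g \<in> W \<inter> Arr D \<and> g \<cdot>\<^bsub>D\<^esub> f \<in> W \<inter> Arr D \<longrightarrow> f \<in> W \<inter> Arr D)"
      using two fg unfolding comp by blast
  qed
  moreover have "Ident D X \<in> W \<inter> Arr D" if "X \<in> Obj D" for X
  proof -
    have "X \<in> Obj C" "Ident D X = Ident C X" "category D"
      using assms(2) that by (auto simp: subcategory_def)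
    then show ?thesis
      using assms(1) category.Ident_Arr[of D X] that by (simp add: weq_category_def)
  qed
  ultimately show ?thesis
    using assms(2) by (simp add: weq_category_def subcategory_def)
qed

lemma homotopical_category_restrict:
  assumes "homotopical_category C W" "subcategory D C"
  shows "homotopical_category D (W \<inter> Arr D)"
proof -
  have "weak_invertibility D (W \<inter> Arr D)"
    unfolding weak_invertibility_def
  proof (intro ballI impI)
    fix f g h
    assume arr: "f \<in> Arr D" "g \<in> Arr D" "h \<in> Arr D"
      and *: "Dom D f = Cod D g \<and> Dom D h = Cod D f \<and> f \<cdot>\<^bsub>D\<^esub> g \<in> W \<inter> Arr D \<and> h \<cdot>\<^bsub>D\<^esub> f \<in> W \<inter> Arr D"
    have "f \<in> Arr C" "g \<in> Arr C" "h \<in> Arr C"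
      using assms(2) arr by (auto simp: subcategory_def)
    moreover have "Dom C f = Cod C g" "Dom C h = Cod C f"
      using assms(2) arr * unfolding subcategory_def by metis+
    moreover have "f \<cdot>\<^bsub>C\<^esub> g \<in> W" "h \<cdot>\<^bsub>C\<^esub> f \<in> W"
      using assms(2) arr * unfolding subcategory_def by (metis IntD1)+
    moreover have "weak_invertibility C W"
      using assms(1) by (simp add: homotopical_category_def)
    ultimately have "f \<in> W" unfolding weak_invertibility_def by blast
    then show "f \<in> W \<inter> Arr D" using arr by simp
  qed
  then show ?thesis
    using assms weq_category_restrict by (auto simp: homotopical_category_def)
qed


section \<open>The quotient of a category by a congruence\<close>

locale arrow_congruence = category C for C :: "('o, 'm) cat" (structure) +
  fixes eq :: "'m \<Rightarrow> 'm \<Rightarrow> bool" (infix "\<approx>" 50)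
  assumes equivp: "equivp (\<approx>)"
    and parallel: "f \<in> hom C X Y \<Longrightarrow> f \<approx> g \<Longrightarrow> g \<in> hom C X Y"
    and comp_cong: "\<lbrakk>f \<in> hom C X Y; g \<in> hom C Y Z; f \<approx> f'; g \<approx> g'\<rbrakk> \<Longrightarrow> g \<cdot> f \<approx> g' \<cdot> f'"
begin

text \<open>
  The arrows of the quotient are chosen representatives instead of classes, so that domain and
  codomain are inherited from \<open>C\<close>.
\<close>

definition rep :: "'m \<Rightarrow> 'm" where
  "rep f = (SOME g. f \<approx> g)"

lemma eq_rep: "f \<approx> rep f"
  unfolding rep_def using equivp_reflp[OF equivp] by (rule someI)

lemma rep_eq_iff: "rep f = rep g \<longleftrightarrow> f \<approx> g"
proof
  assume "rep f = rep g"
  then show "f \<approx> g"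
    using eq_rep[of f] eq_rep[of g] equivp_symp[OF equivp] equivp_transp[OF equivp] by metis
next
  assume "f \<approx> g"
  then have "(\<approx>) f = (\<approx>) g" using equivp by (simp add: equivp_def)
  then show "rep f = rep g" by (simp add: rep_def)
qed

lemma rep_rep [simp]: "rep (rep f) = rep f"
  by (metis eq_rep rep_eq_iff)

lemma rep_hom: "f \<in> hom C X Y \<Longrightarrow> rep f \<in> hom C X Y"
  by (rule parallel[OF _ eq_rep])

lemma rep_comp_rep:
  assumes "f \<in> hom C X Y" "g \<in> hom C Y Z"
  shows "rep (rep g \<cdot> rep f) = rep (g \<cdot> f)" "rep (g \<cdot> rep f) = rep (g \<cdot> f)"
    "rep (rep g \<cdot> f) = rep (g \<cdot> f)"
proof -
  note cong = comp_cong[OF assms]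
  have "g \<cdot> f \<approx> rep g \<cdot> rep f" "g \<cdot> f \<approx> g \<cdot> rep f" "g \<cdot> f \<approx> rep g \<cdot> f"
    using cong eq_rep equivp_reflp[OF equivp] by blast+
  then show "rep (rep g \<cdot> rep f) = rep (g \<cdot> f)" "rep (g \<cdot> rep f) = rep (g \<cdot> f)"
    "rep (rep g \<cdot> f) = rep (g \<cdot> f)"
    unfolding rep_eq_iff by (auto intro: equivp_symp[OF equivp])
qed

definition quotient :: "('o, 'm) cat" where
  "quotient = \<lparr>Obj = Obj C, Arr = rep ` Arr C, Dom = Dom C, Cod = Cod C,
     Ident = (\<lambda>X. rep (Ident C X)), Comp = (\<lambda>g f. rep (g \<cdot> f))\<rparr>"

lemma quotient_simps [simp]:
  "Obj quotient = Obj C" "Dom quotient = Dom C" "Cod quotient = Cod C"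
  "Ident quotient X = rep (Ident C X)" "g \<cdot>\<^bsub>quotient\<^esub> f = rep (g \<cdot> f)"
  by (simp_all add: quotient_def)

lemma Arr_quotient: "f \<in> Arr quotient \<longleftrightarrow> f \<in> Arr C \<and> rep f = f"
proof -
  have "rep g \<in> Arr C" if "g \<in> Arr C" for g
    using rep_hom[of g "Dom C g" "Cod C g"] that by (simp add: hom_def)
  then show ?thesis by (auto simp: quotient_def intro: rev_image_eqI)
qed

lemma hom_quotient: "f \<in> hom quotient X Y \<longleftrightarrow> f \<in> hom C X Y \<and> rep f = f"
  by (auto simp: hom_def Arr_quotient)

lemma category_quotient: "category quotient"
proof
  have C: "category C" by (rule category_axioms)
  show "f \<cdot>\<^bsub>quotient\<^esub> Ident quotient (Dom quotient f) = f"
    "Ident quotient (Cod quotient f) \<cdot>\<^bsub>quotient\<^esub> f = f"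
    "Dom quotient f \<in> Obj quotient" "Cod quotient f \<in> Obj quotient"
    if "f \<in> Arr quotient" for f
  proof -
    have f: "f \<in> hom C (Dom C f) (Cod C f)" "rep f = f"
      using that by (simp_all add: Arr_quotient hom_def)
    note X = hom_Ident[OF C conjunct1[OF hom_Obj[OF C f(1)]]]
      and Y = hom_Ident[OF C conjunct2[OF hom_Obj[OF C f(1)]]]
    show "f \<cdot>\<^bsub>quotient\<^esub> Ident quotient (Dom quotient f) = f"
      using rep_comp_rep(2)[OF X f(1)] f comp_Ident_hom[OF C f(1)] by simp
    show "Ident quotient (Cod quotient f) \<cdot>\<^bsub>quotient\<^esub> f = f"
      using rep_comp_rep(3)[OF f(1) Y] f Ident_comp_hom[OF C f(1)] by simp
    show "Dom quotient f \<in> Obj quotient" "Cod quotient f \<in> Obj quotient"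
      using hom_Obj[OF C f(1)] by simp_all
  qed
  show "Ident quotient X \<in> Arr quotient" "Dom quotient (Ident quotient X) = X"
    "Cod quotient (Ident quotient X) = X" if "X \<in> Obj quotient" for X
    using rep_hom[OF hom_Ident[OF C, of X]] that by (simp_all add: Arr_quotient hom_def)
  fix f g
  assume "f \<in> Arr quotient" "g \<in> Arr quotient" "Dom quotient g = Cod quotient f"
  then have f: "f \<in> hom C (Dom C f) (Cod C f)" and g: "g \<in> hom C (Cod C f) (Cod C g)"
    by (simp_all add: Arr_quotient hom_def)
  note gf = rep_hom[OF hom_Comp[OF C f g]]
  then show "g \<cdot>\<^bsub>quotient\<^esub> f \<in> Arr quotient"
    "Dom quotient (g \<cdot>\<^bsub>quotient\<^esub> f) = Dom quotient f"
    "Cod quotient (g \<cdot>\<^bsub>quotient\<^esub> f) = Cod quotient g"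
    by (simp_all add: Arr_quotient hom_def)
  fix h
  assume "h \<in> Arr quotient" "Dom quotient h = Cod quotient g"
  then have h: "h \<in> hom C (Cod C g) (Cod C h)"
    by (simp add: Arr_quotient hom_def)
  show "h \<cdot>\<^bsub>quotient\<^esub> (g \<cdot>\<^bsub>quotient\<^esub> f) = h \<cdot>\<^bsub>quotient\<^esub> g \<cdot>\<^bsub>quotient\<^esub> f"
    using rep_comp_rep(2)[OF hom_Comp[OF C f g] h] rep_comp_rep(3)[OF f hom_Comp[OF C g h]]
      comp_assoc_hom[OF C f g h] by simp
qed

lemma functor_rep: "is_functor C quotient (\<lambda>X. X) rep"
  unfolding is_functor_def
proof (intro conjI ballI impI)
  fix f assume "f \<in> Arr C"
  then have "f \<in> hom C (Dom C f) (Cod C f)" by (simp add: hom_def)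
  from rep_hom[OF this] show "rep f \<in> hom quotient (Dom C f) (Cod C f)"
    by (simp add: hom_quotient)
next
  fix f g assume "f \<in> Arr C" "g \<in> Arr C" "Dom C g = Cod C f"
  then have "f \<in> hom C (Dom C f) (Cod C f)" "g \<in> hom C (Cod C f) (Cod C g)"
    by (simp_all add: hom_def)
  from rep_comp_rep(1)[OF this] show "rep (g \<cdot> f) = rep g \<cdot>\<^bsub>quotient\<^esub> rep f" by simp
qed simp_all

lemma isomorphism_rep_iff:
  assumes f: "f \<in> hom C X Y"
  shows "isomorphism quotient (rep f) \<longleftrightarrow>
    (\<exists>g \<in> hom C Y X. g \<cdot> f \<approx> Ident C X \<and> f \<cdot> g \<approx> Ident C Y)"
proof -
  have *: "rep f \<in> hom quotient X Y" using rep_hom[OF f] by (simp add: hom_quotient)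
  have iff: "(rep (rep g \<cdot> rep f) = rep (Ident C X) \<and> rep (rep f \<cdot> rep g) = rep (Ident C Y))
      \<longleftrightarrow> (g \<cdot> f \<approx> Ident C X \<and> f \<cdot> g \<approx> Ident C Y)" if g: "g \<in> hom C Y X" for g
    unfolding rep_comp_rep(1)[OF f g] rep_comp_rep(1)[OF g f] unfolding rep_eq_iff ..
  show ?thesis
    unfolding isomorphism_hom_iff[OF *] quotient_simps
  proof
    assume "\<exists>g\<in>hom quotient Y X.
      rep (g \<cdot> rep f) = rep (Ident C X) \<and> rep (rep f \<cdot> g) = rep (Ident C Y)"
    then obtain g where g: "g \<in> hom C Y X" "rep g = g"
      "rep (g \<cdot> rep f) = rep (Ident C X) \<and> rep (rep f \<cdot> g) = rep (Ident C Y)"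
      using hom_quotient by blast
    then show "\<exists>g \<in> hom C Y X. g \<cdot> f \<approx> Ident C X \<and> f \<cdot> g \<approx> Ident C Y"
      using iff[OF g(1), unfolded g(2)] by blast
  next
    assume "\<exists>g \<in> hom C Y X. g \<cdot> f \<approx> Ident C X \<and> f \<cdot> g \<approx> Ident C Y"
    then obtain g where g: "g \<in> hom C Y X" "g \<cdot> f \<approx> Ident C X \<and> f \<cdot> g \<approx> Ident C Y" by blast
    show "\<exists>g\<in>hom quotient Y X.
      rep (g \<cdot> rep f) = rep (Ident C X) \<and> rep (rep f \<cdot> g) = rep (Ident C Y)"
    proof (rule bexI)
      show "rep (rep g \<cdot> rep f) = rep (Ident C X) \<and> rep (rep f \<cdot> rep g) = rep (Ident C Y)"
        using iff[OF g(1)] g(2) by blast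
      show "rep g \<in> hom quotient Y X" using rep_hom[OF g(1)] by (simp add: hom_quotient)
    qed
  qed
qed

end


section \<open>Homotopy\<close>

definition elementary_homotopy :: "('o, 'm) cat \<Rightarrow> 'm set \<Rightarrow> 'm \<Rightarrow> 'm \<Rightarrow> bool" where
  "elementary_homotopy C W f g \<longleftrightarrow>
     (\<exists>A B K A' \<alpha> d\<^sub>0 d\<^sub>1 \<sigma> h. left_fork C W A B f g K A' \<alpha> d\<^sub>0 d\<^sub>1 \<sigma> h)"

definition homotopic :: "('o, 'm) cat \<Rightarrow> 'm set \<Rightarrow> 'm \<Rightarrow> 'm \<Rightarrow> bool" where
  "homotopic C W = (elementary_homotopy C W)\<^sup>*\<^sup>*"

lemma left_fork_ends:
  assumes "category C" "left_fork C W A B f g K A' \<alpha> d\<^sub>0 d\<^sub>1 \<sigma> h"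
  shows "f \<in> hom C A B" "g \<in> hom C A B"
  using assms hom_Comp[OF assms(1), of _ A A' h B] by (auto simp: left_fork_def)

lemma elementary_homotopy_parallel:
  assumes "category C" "elementary_homotopy C W f g" "f \<in> hom C X Y"
  shows "g \<in> hom C X Y"
  using assms left_fork_ends[OF assms(1)] by (fastforce simp: elementary_homotopy_def hom_def)

lemma elementary_homotopy_sym:
  "elementary_homotopy C W f g \<Longrightarrow> elementary_homotopy C W g f"
  unfolding elementary_homotopy_def left_fork_def by blast

lemma elementary_homotopy_postcomp:
  assumes C: "category C" and fg: "elementary_homotopy C W f g"
    and f: "f \<in> hom C X Y" and u: "u \<in> hom C Y Z"
  shows "elementary_homotopy C W (u \<cdot>\<^bsub>C\<^esub> f) (u \<cdot>\<^bsub>C\<^esub> g)"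
proof -
  obtain A B K A' \<alpha> d\<^sub>0 d\<^sub>1 \<sigma> h where fork: "left_fork C W A B f g K A' \<alpha> d\<^sub>0 d\<^sub>1 \<sigma> h"
    using fg unfolding elementary_homotopy_def by blast
  then have "A = X" "B = Y" using left_fork_ends[OF C fork] f by (auto simp: hom_def)
  then have "left_fork C W X Z (u \<cdot>\<^bsub>C\<^esub> f) (u \<cdot>\<^bsub>C\<^esub> g) K A' \<alpha> d\<^sub>0 d\<^sub>1 \<sigma> (u \<cdot>\<^bsub>C\<^esub> h)"
    using fork u comp_assoc_hom[OF C _ _ u] hom_Comp[OF C _ u] by (auto simp: left_fork_def)
  then show ?thesis unfolding elementary_homotopy_def by blast
qed

text \<open>
  This is why homotopies allow an arbitrary \<open>\<alpha>\<close>. Precomposing with \<open>v\<close> replaces \<open>\<alpha>\<close> by \<open>\<alpha> \<cdot> v\<close>,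
  which need not be a weak equivalence even if \<open>\<alpha>\<close> is one, so that the argument would break down
  for a relation that restricted \<open>\<alpha>\<close> to weak equivalences.
\<close>

lemma elementary_homotopy_precomp:
  assumes C: "category C" and fg: "elementary_homotopy C W f g"
    and v: "v \<in> hom C X Y" and f: "f \<in> hom C Y Z"
  shows "elementary_homotopy C W (f \<cdot>\<^bsub>C\<^esub> v) (g \<cdot>\<^bsub>C\<^esub> v)"
proof -
  obtain A B K A' \<alpha> d\<^sub>0 d\<^sub>1 \<sigma> h where fork: "left_fork C W A B f g K A' \<alpha> d\<^sub>0 d\<^sub>1 \<sigma> h"
    using fg unfolding elementary_homotopy_def by blast
  then have "A = Y" "B = Z" using left_fork_ends[OF C fork] f by (auto simp: hom_def)
  then have "left_fork C W X Z (f \<cdot>\<^bsub>C\<^esub> v) (g \<cdot>\<^bsub>C\<^esub> v) K A' (\<alpha> \<cdot>\<^bsub>C\<^esub> v) (d\<^sub>0 \<cdot>\<^bsub>C\<^esub> v) (d\<^sub>1 \<cdot>\<^bsub>C\<^esub> v) \<sigma> h"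
    using fork comp_assoc_hom[OF C v] hom_Comp[OF C v] by (auto simp: left_fork_def)
  then show ?thesis unfolding elementary_homotopy_def by blast
qed

lemma homotopic_parallel:
  assumes "category C" "homotopic C W f g" "f \<in> hom C X Y"
  shows "g \<in> hom C X Y"
  using assms(2,3) unfolding homotopic_def
  by (induction rule: rtranclp_induct) (auto intro: elementary_homotopy_parallel[OF assms(1)])

lemma homotopic_postcomp:
  assumes "category C" "homotopic C W f g" "f \<in> hom C X Y" "u \<in> hom C Y Z"
  shows "homotopic C W (u \<cdot>\<^bsub>C\<^esub> f) (u \<cdot>\<^bsub>C\<^esub> g)"
  using assms(2) unfolding homotopic_def
proof (induction rule: rtranclp_induct)
  case (step y z)
  have "y \<in> hom C X Y"
    using homotopic_parallel[OF assms(1) _ assms(3)] step(1) by (simp add: homotopic_def)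
  then show ?case
    using step elementary_homotopy_postcomp[OF assms(1) step(2) _ assms(4)]
    by (meson rtranclp.rtrancl_into_rtrancl)
qed simp

lemma homotopic_precomp:
  assumes "category C" "homotopic C W f g" "v \<in> hom C X Y" "f \<in> hom C Y Z"
  shows "homotopic C W (f \<cdot>\<^bsub>C\<^esub> v) (g \<cdot>\<^bsub>C\<^esub> v)"
  using assms(2) unfolding homotopic_def
proof (induction rule: rtranclp_induct)
  case (step y z)
  have "y \<in> hom C Y Z"
    using homotopic_parallel[OF assms(1) _ assms(4)] step(1) by (simp add: homotopic_def)
  then show ?case
    using step elementary_homotopy_precomp[OF assms(1) step(2) assms(3)]
    by (meson rtranclp.rtrancl_into_rtrancl)
qed simp

lemma equivp_homotopic: "equivp (homotopic C W)"
  unfolding homotopic_def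
  by (intro equivpI reflpI transpI symp_rtranclp)
    (auto intro: sympI elementary_homotopy_sym)

lemma arrow_congruence_homotopic:
  assumes C: "category C"
  shows "arrow_congruence C (homotopic C W)"
proof (intro arrow_congruence.intro arrow_congruence_axioms.intro C equivp_homotopic)
  fix f f' g g' X Y Z
  assume f: "f \<in> hom C X Y" and g: "g \<in> hom C Y Z"
    and ff': "homotopic C W f f'" and gg': "homotopic C W g g'"
  have "homotopic C W (g \<cdot>\<^bsub>C\<^esub> f) (g \<cdot>\<^bsub>C\<^esub> f')"
    using homotopic_postcomp[OF C ff' f g] .
  moreover have "homotopic C W (g \<cdot>\<^bsub>C\<^esub> f') (g' \<cdot>\<^bsub>C\<^esub> f')"
    using homotopic_precomp[OF C gg' homotopic_parallel[OF C ff' f] g] .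
  ultimately show "homotopic C W (g \<cdot>\<^bsub>C\<^esub> f) (g' \<cdot>\<^bsub>C\<^esub> f')"
    by (rule equivp_transp[OF equivp_homotopic])
qed (rule homotopic_parallel[OF C])

text \<open>
  The retraction \<open>r\<close> equalizes \<open>w \<cdot> r\<close> and the identity, so it serves as \<open>\<sigma>\<close>, with \<open>h\<close> the
  identity. The lemma is used in both directions: for a weak equivalence \<open>w\<close> that is a section,
  and, with a weak equivalence in the place of \<open>r\<close>, for one that is a retraction.
\<close>

lemma section_homotopy_inverse:
  assumes C: "category C" and w: "w \<in> hom C X Y" and r: "r \<in> hom C Y X"
    and rw: "r \<cdot>\<^bsub>C\<^esub> w = Ident C X" and "r \<in> W"
  shows "homotopic C W (w \<cdot>\<^bsub>C\<^esub> r) (Ident C Y)"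
proof -
  have Y: "Ident C Y \<in> hom C Y Y" using hom_Ident[OF C] hom_Obj[OF C w] by blast
  have wr: "w \<cdot>\<^bsub>C\<^esub> r \<in> hom C Y Y" by (rule hom_Comp[OF C r w])
  have "r \<cdot>\<^bsub>C\<^esub> (w \<cdot>\<^bsub>C\<^esub> r) = r"
    using comp_assoc_hom[OF C r w r] rw Ident_comp_hom[OF C r] by simp
  then have "left_fork C W Y Y (w \<cdot>\<^bsub>C\<^esub> r) (Ident C Y) X Y r (w \<cdot>\<^bsub>C\<^esub> r) (Ident C Y) r (Ident C Y)"
    using assms Y wr Ident_comp_hom[OF C wr] Ident_comp_hom[OF C Y] comp_Ident_hom[OF C r]
    by (simp add: left_fork_def)
  then show ?thesis unfolding homotopic_def elementary_homotopy_def by blast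
qed

lemma compositions_subset_Arr:
  assumes "category C" "S \<subseteq> Arr C" "w \<in> compositions C S"
  shows "w \<in> Arr C"
  using assms(3) by induction (use assms(1,2) in \<open>auto simp: category.Comp_Arr\<close>)

text \<open>
  Inverting the split weak equivalences in the quotient is enough for the localization to map to
  the quotient; since the quotient functor is full, the inverse of \<open>\<gamma> f\<close> is represented there by
  a single arrow of \<open>C\<close>.
\<close>

lemma homotopy_inverse_exists:
  assumes weq: "weq_category C W" and split: "split_generated C W"
    and f: "f \<in> hom C X Y" and iso: "isomorphism (Ho C W) (\<gamma> C W f)"
  shows "\<exists>g \<in> hom C Y X. homotopic C W (g \<cdot>\<^bsub>C\<^esub> f) (Ident C X) \<and> homotopic C W (f \<cdot>\<^bsub>C\<^esub> g) (Ident C Y)"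
proof -
  have C: "category C" and W: "W \<subseteq> Arr C"
    and id: "\<And>X. X \<in> Obj C \<Longrightarrow> Ident C X \<in> W"
    using weq by (auto simp: weq_category_def)
  interpret arrow_congruence C "homotopic C W" by (rule arrow_congruence_homotopic[OF C])
  have refl: "homotopic C W g g" for g by (rule equivp_reflp[OF equivp_homotopic])
  have split_iso: "isomorphism quotient (rep w)"
    if w: "w \<in> W" and split: "is_section C w \<or> is_retraction C w" for w
  proof -
    let ?X = "Dom C w" and ?Y = "Cod C w"
    have wh: "w \<in> hom C ?X ?Y" using w W by (auto simp: hom_def)
    have I: "Ident C ?X \<in> W" "Ident C ?Y \<in> W" using id hom_Obj[OF C wh] by blast+
    consider r where "r \<in> hom C ?Y ?X" "r \<cdot>\<^bsub>C\<^esub> w = Ident C ?X"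
      | s where "s \<in> hom C ?Y ?X" "w \<cdot>\<^bsub>C\<^esub> s = Ident C ?Y"
      using split by (auto simp: is_section_def is_retraction_def)
    then show ?thesis
    proof cases
      case 1
      have "r \<in> W"
        using weq_two_out_of_three[OF weq wh 1(1)] w I 1(2) by simp
      then have "homotopic C W (w \<cdot>\<^bsub>C\<^esub> r) (Ident C ?Y)"
        by (rule section_homotopy_inverse[OF C wh 1])
      moreover have "homotopic C W (r \<cdot>\<^bsub>C\<^esub> w) (Ident C ?X)" using 1(2) refl by simp
      ultimately show ?thesis using isomorphism_rep_iff[OF wh] 1(1) by blast
    next
      case 2
      have "homotopic C W (s \<cdot>\<^bsub>C\<^esub> w) (Ident C ?X)"
        by (rule section_homotopy_inverse[OF C 2(1) wh 2(2) w])
      moreover have "homotopic C W (w \<cdot>\<^bsub>C\<^esub> s) (Ident C ?Y)" using 2(2) refl by simp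
      ultimately show ?thesis using isomorphism_rep_iff[OF wh] 2(1) by blast
    qed
  qed
  have "isomorphism quotient (rep w)"
    if "w \<in> compositions C {w \<in> W. is_section C w \<or> is_retraction C w}" for w
    using that
  proof induction
    case (single w)
    then show ?case using split_iso by simp
  next
    case (comp v w)
    have v: "v \<in> hom C (Dom C v) (Cod C v)" using comp W by (auto simp: hom_def)
    have "w \<in> Arr C"
      using compositions_subset_Arr[OF C _ comp(2)] W by blast
    then have w: "w \<in> hom C (Cod C v) (Cod C w)" using comp by (simp add: hom_def)
    note q = functor_rep
    show ?case
      using isomorphism_comp[OF category_quotient functor_hom[OF q v] functor_hom[OF q w]]
        comp split_iso functor_comp[OF q v w] by simp
  qed
  then have "\<forall>w \<in> W. isomorphism quotient (rep w)"
    using split by (auto simp: split_generated_def)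
  then have "isomorphism quotient (rep f)"
    using isomorphism_of_localized_isomorphism[OF C W category_quotient functor_rep _ _ iso] f
    by (simp add: hom_def)
  then show ?thesis using isomorphism_rep_iff[OF f] by simp
qed


section \<open>Saturation from the fork condition\<close>

text \<open>
  Once \<open>\<alpha>\<close> and \<open>\<sigma>\<close> are weak equivalences, so are \<open>d\<^sub>0\<close> and \<open>d\<^sub>1\<close>, and both \<open>h \<cdot> d\<^sub>0\<close> and \<open>h \<cdot> d\<^sub>1\<close>
  are weak equivalences exactly when \<open>h\<close> is.
\<close>

lemma elementary_homotopy_weq_iff:
  assumes weq: "weq_category C W" and fork: "fork_condition C W"
    and fg: "elementary_homotopy C W f g"
  shows "f \<in> W \<longleftrightarrow> g \<in> W"
proof -
  have C: "category C" using weq by (simp add: weq_category_def)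
  obtain A B where ex: "\<exists>K A' \<alpha> d\<^sub>0 d\<^sub>1 \<sigma> h. left_fork C W A B f g K A' \<alpha> d\<^sub>0 d\<^sub>1 \<sigma> h"
    using fg unfolding elementary_homotopy_def by blast
  then have fh: "f \<in> hom C A B" and gh: "g \<in> hom C A B" by (blast dest: left_fork_ends[OF C])+
  have AB: "A \<in> Obj C" "B \<in> Obj C" using hom_Obj[OF C fh] by auto
  obtain K A' \<alpha> d\<^sub>0 d\<^sub>1 \<sigma> h where *: "left_fork C W A B f g K A' \<alpha> d\<^sub>0 d\<^sub>1 \<sigma> h" "\<alpha> \<in> W"
    using conjunct1[OF bspec[OF bspec[OF bspec[OF bspec[OF
      fork[unfolded fork_condition_def] AB(1)] AB(2)] fh] gh]] ex by blast
  then have d: "d\<^sub>0 \<in> hom C A A'" "d\<^sub>1 \<in> hom C A A'" and \<sigma>: "\<sigma> \<in> hom C A' K" and h: "h \<in> hom C A' B"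
    and "\<sigma> \<in> W" "\<sigma> \<cdot>\<^bsub>C\<^esub> d\<^sub>0 \<in> W" "\<sigma> \<cdot>\<^bsub>C\<^esub> d\<^sub>1 \<in> W" "h \<cdot>\<^bsub>C\<^esub> d\<^sub>0 = f" "h \<cdot>\<^bsub>C\<^esub> d\<^sub>1 = g"
    by (auto simp: left_fork_def)
  moreover from this have "d\<^sub>0 \<in> W" "d\<^sub>1 \<in> W"
    using weq_two_out_of_three[OF weq d(1) \<sigma>] weq_two_out_of_three[OF weq d(2) \<sigma>] by blast+
  ultimately show ?thesis using weq_two_out_of_three[OF weq d(1) h] weq_two_out_of_three[OF weq d(2) h] by blast
qed

lemma homotopic_weq_iff:
  assumes "weq_category C W" "fork_condition C W" "homotopic C W f g"
  shows "f \<in> W \<longleftrightarrow> g \<in> W"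
  using assms(3) unfolding homotopic_def
  by (induction rule: rtranclp_induct) (auto simp: elementary_homotopy_weq_iff[OF assms(1,2)])

lemma saturated_of_fork_condition:
  assumes hc: "homotopical_category C W" and "split_generated C W" and fork: "fork_condition C W"
  shows "saturated C W"
  unfolding saturated_def
proof (intro ballI impI)
  fix f assume f: "f \<in> Arr C" and iso: "isomorphism (Ho C W) (\<gamma> C W f)"
  have weq: "weq_category C W" using hc by (simp add: homotopical_category_def)
  have fh: "f \<in> hom C (Dom C f) (Cod C f)" using f by (simp add: hom_def)
  have C: "category C" using weq by (simp add: weq_category_def)
  obtain g where g: "g \<in> hom C (Cod C f) (Dom C f)"
    and "homotopic C W (g \<cdot>\<^bsub>C\<^esub> f) (Ident C (Dom C f))" "homotopic C W (f \<cdot>\<^bsub>C\<^esub> g) (Ident C (Cod C f))"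
    using homotopy_inverse_exists[OF weq assms(2) fh iso] by blast
  then have "g \<cdot>\<^bsub>C\<^esub> f \<in> W" "f \<cdot>\<^bsub>C\<^esub> g \<in> W"
    using homotopic_weq_iff[OF weq fork] weq hom_Obj[OF C fh] by (auto simp: weq_category_def)
  then show "f \<in> W"
    using hc f g by (auto simp: homotopical_category_def weak_invertibility_def hom_def)
qed


section \<open>Transport of saturation along deformations\<close>

lemma deformation_functor_into:
  assumes def: "deformation_functor C W D ro ra" and sub: "subcategory D C"
  shows "is_functor C D ro ra"
proof -
  have r: "is_functor C C ro ra" and ro: "X \<in> Obj C \<Longrightarrow> ro X \<in> Obj D"
    and ra: "f \<in> Arr C \<Longrightarrow> ra f \<in> Arr D" for X f
    using def by (simp_all add: deformation_functor_def)
  have hom: "ra f \<in> hom D (ro (Dom C f)) (ro (Cod C f))" if "f \<in> Arr C" for f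
  proof -
    have "ra f \<in> hom C (ro (Dom C f)) (ro (Cod C f))" using r that by (simp add: is_functor_def)
    then show ?thesis using ra[OF that] sub by (simp add: hom_def subcategory_def)
  qed
  have "ra (g \<cdot>\<^bsub>C\<^esub> f) = ra g \<cdot>\<^bsub>D\<^esub> ra f"
    if fg: "f \<in> Arr C" "g \<in> Arr C" "Dom C g = Cod C f" for f g
  proof -
    have "Dom D (ra g) = Cod D (ra f)" using hom[OF fg(1)] hom[OF fg(2)] fg(3) by (simp add: hom_def)
    then have "ra g \<cdot>\<^bsub>D\<^esub> ra f = ra g \<cdot>\<^bsub>C\<^esub> ra f"
      using ra[OF fg(1)] ra[OF fg(2)] sub unfolding subcategory_def by blast
    then show ?thesis using r fg by (simp add: is_functor_def)
  qed
  moreover have "ra (Ident C X) = Ident D (ro X)" if "X \<in> Obj C" for X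
    using r sub ro[OF that] that by (simp add: is_functor_def subcategory_def)
  ultimately show ?thesis using hom ro by (simp add: is_functor_def)
qed

text \<open>
  The functor induced by \<open>r\<close> on localizations shows that \<open>r f\<close> is invertible in the localization of
  \<open>D\<close>; the naturality square at \<open>f\<close>, with sides \<open>\<theta>\<close> in \<open>W\<close>, then carries \<open>r f \<in> W\<close> over to \<open>f\<close>.
\<close>

lemma saturated_of_deformation:
  assumes weq: "weq_category C W" and sub: "subcategory D C"
    and def: "left_deformation C W D ro ra \<theta> \<or> right_deformation C W D ro ra \<theta>"
    and sat: "saturated D (W \<inter> Arr D)"
  shows "saturated C W"
  unfolding saturated_def
proof (intro ballI impI)
  fix f assume f: "f \<in> Arr C" and iso: "isomorphism (Ho C W) (\<gamma> C W f)"
  have C: "category C" and W: "W \<subseteq> Arr C"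
    using weq by (auto simp: weq_category_def)
  have D: "category D" using sub by (simp add: subcategory_def)
  have r: "deformation_functor C W D ro ra"
    using def by (auto simp: left_deformation_def right_deformation_def)
  let ?WD = "W \<inter> Arr D"
  have "\<forall>w \<in> W. isomorphism (Ho D ?WD) (\<gamma> D ?WD (ra w))"
  proof
    fix w assume "w \<in> W"
    then have "ra w \<in> ?WD" "ra w \<in> Arr D" using r W by (auto simp: deformation_functor_def)
    from \<gamma>_inverse[OF D this] show "isomorphism (Ho D ?WD) (\<gamma> D ?WD (ra w))"
      unfolding isomorphism_def by blast
  qed
  from isomorphism_of_localized_isomorphism[OF C W category_Ho[OF D]
      functor_compose[OF deformation_functor_into[OF r sub] functor_\<gamma>[OF D]] this f iso]
  have "ra f \<in> W"
    using sat f r by (auto simp: saturated_def deformation_functor_def)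
  have fh: "f \<in> hom C (Dom C f) (Cod C f)" using f by (simp add: hom_def)
  have rf: "ra f \<in> hom C (ro (Dom C f)) (ro (Cod C f))"
    using r f by (simp add: deformation_functor_def is_functor_def)
  have ob: "Dom C f \<in> Obj C" "Cod C f \<in> Obj C" using hom_Obj[OF C fh] by auto
  from def have \<theta>W: "\<theta> (Dom C f) \<in> W" "\<theta> (Cod C f) \<in> W"
    using ob by (auto simp: left_deformation_def right_deformation_def)
  from def show "f \<in> W"
  proof
    assume "left_deformation C W D ro ra \<theta>"
    then have \<theta>: "\<theta> (Dom C f) \<in> hom C (ro (Dom C f)) (Dom C f)"
      "\<theta> (Cod C f) \<in> hom C (ro (Cod C f)) (Cod C f)"
      and nat: "\<theta> (Cod C f) \<cdot>\<^bsub>C\<^esub> ra f = f \<cdot>\<^bsub>C\<^esub> \<theta> (Dom C f)"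
      using f ob by (simp_all add: left_deformation_def nat_transf_def)
    have "f \<cdot>\<^bsub>C\<^esub> \<theta> (Dom C f) \<in> W"
      using weq_two_out_of_three[OF weq rf \<theta>(2)] \<theta>W \<open>ra f \<in> W\<close> nat by simp
    then show ?thesis using weq_two_out_of_three[OF weq \<theta>(1) fh] \<theta>W by blast
  next
    assume "right_deformation C W D ro ra \<theta>"
    then have \<theta>: "\<theta> (Dom C f) \<in> hom C (Dom C f) (ro (Dom C f))"
      "\<theta> (Cod C f) \<in> hom C (Cod C f) (ro (Cod C f))"
      and nat: "\<theta> (Cod C f) \<cdot>\<^bsub>C\<^esub> f = ra f \<cdot>\<^bsub>C\<^esub> \<theta> (Dom C f)"
      using f ob by (simp_all add: right_deformation_def nat_transf_def)
    have "\<theta> (Cod C f) \<cdot>\<^bsub>C\<^esub> f \<in> W"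
      using weq_two_out_of_three[OF weq \<theta>(1) rf] \<theta>W \<open>ra f \<in> W\<close> nat by simp
    then show ?thesis using weq_two_out_of_three[OF weq fh \<theta>(2)] \<theta>W by blast
  qed
qed

lemma saturated_of_deformable:
  assumes weq: "weq_category C W" and "deformable C W C\<^sub>0" and sat: "saturated C\<^sub>0 (W \<inter> Arr C\<^sub>0)"
  shows "saturated C W"
proof -
  have C: "category C" and W: "W \<subseteq> Arr C" using weq by (auto simp: weq_category_def)
  obtain n D where D: "D 0 = C" "D n = C\<^sub>0" and sub: "\<And>i. i < n \<Longrightarrow> subcategory (D (Suc i)) (D i)"
    and def: "\<And>i. i < n \<Longrightarrow> \<exists>ro ra \<theta>. left_deformation (D i) (W \<inter> Arr (D i)) (D (Suc i)) ro ra \<theta> \<or>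
                   right_deformation (D i) (W \<inter> Arr (D i)) (D (Suc i)) ro ra \<theta>"
    using assms(2) unfolding deformable_def by blast
  have subC: "i \<le> n \<Longrightarrow> subcategory (D i) C" for i
  proof (induction i)
    case 0
    then show ?case using D subcategory_refl[OF C] by simp
  next
    case (Suc i)
    then show ?case using subcategory_trans[OF sub] by simp
  qed
  have "saturated (D 0) (W \<inter> Arr (D 0))"
  proof (rule inc_induct[of 0 n])
    show "saturated (D n) (W \<inter> Arr (D n))" using sat D by simp
  next
    fix i assume i: "i < n" and "saturated (D (Suc i)) (W \<inter> Arr (D (Suc i)))"
    moreover have "W \<inter> Arr (D i) \<inter> Arr (D (Suc i)) = W \<inter> Arr (D (Suc i))"
      using sub[OF i] by (auto simp: subcategory_def)
    moreover have "weq_category (D i) (W \<inter> Arr (D i))"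
      using weq_category_restrict[OF weq subC] i by simp
    moreover obtain ro ra \<theta> where "left_deformation (D i) (W \<inter> Arr (D i)) (D (Suc i)) ro ra \<theta> \<or>
        right_deformation (D i) (W \<inter> Arr (D i)) (D (Suc i)) ro ra \<theta>"
      using def[OF i] by blast
    ultimately show "saturated (D i) (W \<inter> Arr (D i))"
      using saturated_of_deformation[OF _ sub[OF i]] by simp
  qed simp
  then show ?thesis using D W by (simp add: Int_absorb2)
qed

theorem corollary3p5p15:
  fixes C C\<^sub>0 :: "('o, 'm) cat" and W :: "'m set"
  assumes "homotopical_category C W"
    and "subcategory C\<^sub>0 C"
    and "deformable C W C\<^sub>0"
    and "split_generated C\<^sub>0 (W \<inter> Arr C\<^sub>0)"
    and "fork_condition C\<^sub>0 (W \<inter> Arr C\<^sub>0)"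
  shows "saturated C W"
proof (rule saturated_of_deformable)
  show "weq_category C W" using assms(1) by (simp add: homotopical_category_def)
  show "saturated C\<^sub>0 (W \<inter> Arr C\<^sub>0)"
    using saturated_of_fork_condition[OF homotopical_category_restrict] assms by blast
qed (rule assms(3))

end
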